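(* Let $T$ be a complete $\mathcal{L}$-theory of fields, $M$ a sufficiently saturated model of $T$ contained in a sufficiently saturated algebraically closed field $M_0$, and $\mathcal{K}$ a strong class of $\mathcal{L}$-substructures of $M$. Suppose that Hypotheses 1, 2 and 3 (listed in the context) hold. Then for every $A\in\mathcal{K}$, $$\operatorname{dcl}_{\mathcal{L}}(A)=\operatorname{dcl}_0(A)\cap M=A .$$
   Context: Setting: $\mathcal{L}_0=\{0,1,+,-,\cdot,{}^{-1}\}$ is the language of fields, $\mathcal{L}\supseteq\mathcal{L}_0$, and $T$ is a complete $\mathcal{L}$-theory whose models are fields of a fixed characteristic $p$ (prime or $0$). $\operatorname{dcl}_{\mathcal{L}},\operatorname{acl}_{\mathcal{L}}$ denote definable and algebraic closure in $M$ in the sense of $T$; $\operatorname{dcl}_0,\operatorname{acl}_0$ denote definable and algebraic closure in $M_0$ in the sense of the theory $ACF_p$ of algebraically closed fields (so $\operatorname{acl}_0$ is the field-theoretic algebraic closure of the generated field). A class $\mathcal{K}$ of $\mathcal{L}$-substructures of $M$ is strong if every $\mathcal{L}$-isomorphism $f:A\to A'$ with $A,A'\in\mathcal{K}$ is elementary (in the sense of $T$). A field extension $F/K$ is separable if the characteristic is $0$, or if the characteristic is $p>0$ and $K$ and $F^p$ are linearly disjoint over $K^p$. Hypothesis 1: $\mathcal{K}$ contains all $\mathcal{L}$-definably closed subsets of $M$. Hypothesis 2: (1) models of $T$ are separably closed as fields; (2) if $A\in\mathcal{K}$, then the field extension $M/A$ is separable. Hypothesis 3: for every $A\in\mathcal{K}$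 we have $\operatorname{acl}_{\mathcal{L}}(A)=\operatorname{acl}_0(A)\cap M$ (in particular this set is an $\mathcal{L}$-substructure); moreover, every field isomorphism $f:\operatorname{acl}_0(A)\cap M\to\operatorname{acl}_0(A)\cap M$ fixing $A$ pointwise is an $\mathcal{L}$-isomorphism. *)

theory Defs
  imports "HOL-Algebra.Algebraic_Closure_Type"
begin

subsection \<open>Languages, terms, formulas\<close>

text \<open>
  The symbols of the language of fields are distinguished constructors; \<open>Fn f n\<close> is a further
  function symbol of arity \<open>n\<close>, and \<open>(r, n)\<close> is a relation symbol of arity \<open>n\<close>. The symbol \<open>-\<close> is
  read as unary. A language is a set of symbols, so that inclusion of languages is inclusion.
\<close>

datatype 'f fsym = FZero | FOne | FPlus | FNeg | FTimes | FInv | Fn 'f nat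

type_synonym 'r rsym = "'r \<times> nat"

fun arity :: "'f fsym \<Rightarrow> nat" where
  "arity FZero = 0"
| "arity FOne = 0"
| "arity FPlus = 2"
| "arity FNeg = 1"
| "arity FTimes = 2"
| "arity FInv = 1"
| "arity (Fn f n) = n"

record ('f, 'r) lang =
  fsyms :: "'f fsym set"
  rsyms :: "'r rsym set"

definition field_lang :: "('f, 'r) lang" where
  "field_lang = \<lparr>fsyms = {FZero, FOne, FPlus, FNeg, FTimes, FInv}, rsyms = {}\<rparr>"

definition sublang :: "('f, 'r) lang \<Rightarrow> ('f, 'r) lang \<Rightarrow> bool" where
  "sublang L L' \<longleftrightarrow> fsyms L \<subseteq> fsyms L' \<and> rsyms L \<subseteq> rsyms L'"

datatype 'f tm = TVar nat | TApp "'f fsym" "'f tm list"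

datatype ('f, 'r) fm =
    FEq "'f tm" "'f tm"
  | FRel "'r rsym" "'f tm list"
  | FNot "('f, 'r) fm"
  | FAnd "('f, 'r) fm" "('f, 'r) fm"
  | FEx nat "('f, 'r) fm"

fun term_of :: "('f, 'r) lang \<Rightarrow> 'f tm \<Rightarrow> bool" where
  "term_of L (TVar x) \<longleftrightarrow> True"
| "term_of L (TApp s ts) \<longleftrightarrow> s \<in> fsyms L \<and> length ts = arity s \<and> (\<forall>t\<in>set ts. term_of L t)"

fun formula_of :: "('f, 'r) lang \<Rightarrow> ('f, 'r) fm \<Rightarrow> bool" where
  "formula_of L (FEq t u) \<longleftrightarrow> term_of L t \<and> term_of L u"
| "formula_of L (FRel R ts) \<longleftrightarrow> R \<in> rsyms L \<and> length ts = snd R \<and> (\<forall>t\<in>set ts. term_of L t)"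
| "formula_of L (FNot \<phi>) \<longleftrightarrow> formula_of L \<phi>"
| "formula_of L (FAnd \<phi> \<psi>) \<longleftrightarrow> formula_of L \<phi> \<and> formula_of L \<psi>"
| "formula_of L (FEx x \<phi>) \<longleftrightarrow> formula_of L \<phi>"

fun tm_vars :: "'f tm \<Rightarrow> nat set" where
  "tm_vars (TVar x) = {x}"
| "tm_vars (TApp s ts) = (\<Union>t\<in>set ts. tm_vars t)"

fun free_vars :: "('f, 'r) fm \<Rightarrow> nat set" where
  "free_vars (FEq t u) = tm_vars t \<union> tm_vars u"
| "free_vars (FRel R ts) = (\<Union>t\<in>set ts. tm_vars t)"
| "free_vars (FNot \<phi>) = free_vars \<phi>"
| "free_vars (FAnd \<phi> \<psi>) = free_vars \<phi> \<union> free_vars \<psi>"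
| "free_vars (FEx x \<phi>) = free_vars \<phi> - {x}"

definition sentence_of :: "('f, 'r) lang \<Rightarrow> ('f, 'r) fm \<Rightarrow> bool" where
  "sentence_of L \<phi> \<longleftrightarrow> formula_of L \<phi> \<and> free_vars \<phi> = {}"

subsection \<open>Structures and satisfaction\<close>

text \<open>
  Interpretations are total; only their values at symbols of the language under consideration and
  at argument lists from the universe of the correct length are relevant.
\<close>

record ('u, 'f, 'r) struct =
  univ :: "'u set"
  fint :: "'f fsym \<Rightarrow> 'u list \<Rightarrow> 'u"
  rint :: "'r rsym \<Rightarrow> 'u list \<Rightarrow> bool"

definition is_struct :: "('f, 'r) lang \<Rightarrow> ('u, 'f, 'r) struct \<Rightarrow> bool" where
  "is_struct L N \<longleftrightarrow> univ N \<noteq> {} \<and>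
     (\<forall>s\<in>fsyms L. \<forall>xs. set xs \<subseteq> univ N \<and> length xs = arity s \<longrightarrow> fint N s xs \<in> univ N)"

definition substruct :: "('f, 'r) lang \<Rightarrow> ('u, 'f, 'r) struct \<Rightarrow> ('u, 'f, 'r) struct \<Rightarrow> bool" where
  "substruct L N N' \<longleftrightarrow> is_struct L N \<and> is_struct L N' \<and> univ N \<subseteq> univ N' \<and>
     (\<forall>s\<in>fsyms L. \<forall>xs. set xs \<subseteq> univ N \<and> length xs = arity s \<longrightarrow> fint N s xs = fint N' s xs) \<and>
     (\<forall>R\<in>rsyms L. \<forall>xs. set xs \<subseteq> univ N \<and> length xs = snd R \<longrightarrow> (rint N R xs \<longleftrightarrow> rint N' R xs))"

definition is_iso ::
  "('f, 'r) lang \<Rightarrow> ('u \<Rightarrow> 'v) \<Rightarrow> ('u, 'f, 'r) struct \<Rightarrow> ('v, 'f, 'r) struct \<Rightarrow> bool" where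
  "is_iso L f N N' \<longleftrightarrow> bij_betw f (univ N) (univ N') \<and>
     (\<forall>s\<in>fsyms L. \<forall>xs. set xs \<subseteq> univ N \<and> length xs = arity s \<longrightarrow>
        f (fint N s xs) = fint N' s (map f xs)) \<and>
     (\<forall>R\<in>rsyms L. \<forall>xs. set xs \<subseteq> univ N \<and> length xs = snd R \<longrightarrow>
        (rint N R xs \<longleftrightarrow> rint N' R (map f xs)))"

fun tm_val :: "('u, 'f, 'r) struct \<Rightarrow> (nat \<Rightarrow> 'u) \<Rightarrow> 'f tm \<Rightarrow> 'u" where
  "tm_val N e (TVar x) = e x"
| "tm_val N e (TApp s ts) = fint N s (map (tm_val N e) ts)"

fun sat :: "('u, 'f, 'r) struct \<Rightarrow> (nat \<Rightarrow> 'u) \<Rightarrow> ('f, 'r) fm \<Rightarrow> bool" where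
  "sat N e (FEq t u) \<longleftrightarrow> tm_val N e t = tm_val N e u"
| "sat N e (FRel R ts) \<longleftrightarrow> rint N R (map (tm_val N e) ts)"
| "sat N e (FNot \<phi>) \<longleftrightarrow> \<not> sat N e \<phi>"
| "sat N e (FAnd \<phi> \<psi>) \<longleftrightarrow> sat N e \<phi> \<and> sat N e \<psi>"
| "sat N e (FEx x \<phi>) \<longleftrightarrow> (\<exists>a\<in>univ N. sat N (e(x := a)) \<phi>)"

definition is_model :: "('f, 'r) lang \<Rightarrow> ('u, 'f, 'r) struct \<Rightarrow> ('f, 'r) fm set \<Rightarrow> bool" where
  "is_model L N T \<longleftrightarrow> is_struct L N \<and> (\<forall>\<phi>\<in>T. \<forall>e. sat N e \<phi>)"

text \<open>
  HOL cannot quantify over the types of universes inside a formula, so semantic consequence refers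
  to models whose universe is a subset of a given type. By the Loewenheim-Skolem theorem it does
  not depend on that type as long as the type is infinite and has at least as many elements as
  the language has formulas.
\<close>

definition entails ::
  "'u itself \<Rightarrow> ('f, 'r) lang \<Rightarrow> ('f, 'r) fm set \<Rightarrow> ('f, 'r) fm \<Rightarrow> bool" where
  "entails _ L T \<phi> \<longleftrightarrow> (\<forall>N :: ('u, 'f, 'r) struct. is_model L N T \<longrightarrow> (\<forall>e. sat N e \<phi>))"

definition complete_theory ::
  "'u itself \<Rightarrow> ('f, 'r) lang \<Rightarrow> ('f, 'r) fm set \<Rightarrow> bool" where
  "complete_theory U L T \<longleftrightarrow> (\<forall>\<phi>\<in>T. sentence_of L \<phi>) \<and>
     (\<exists>N :: ('u, 'f, 'r) struct. is_model L N T) \<and>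
     (\<forall>\<phi>. sentence_of L \<phi> \<longrightarrow> entails U L T \<phi> \<or> entails U L T (FNot \<phi>))"

subsection \<open>Definable and algebraic closure, saturation, elementary maps\<close>

text \<open>
  A formula \<open>\<phi>(x, a)\<close> with parameters from \<open>A\<close> is given by \<open>\<phi>\<close> and a valuation \<open>e\<close> sending the free
  variables of \<open>\<phi>\<close> other than the variable \<open>0\<close>, which plays the role of \<open>x\<close>, into \<open>A\<close>.
\<close>

definition param_formula ::
  "('f, 'r) lang \<Rightarrow> 'u set \<Rightarrow> ('f, 'r) fm \<Rightarrow> (nat \<Rightarrow> 'u) \<Rightarrow> bool" where
  "param_formula L A \<phi> e \<longleftrightarrow> formula_of L \<phi> \<and> (\<forall>x \<in> free_vars \<phi> - {0}. e x \<in> A)"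

definition solutions :: "('u, 'f, 'r) struct \<Rightarrow> ('f, 'r) fm \<Rightarrow> (nat \<Rightarrow> 'u) \<Rightarrow> 'u set" where
  "solutions N \<phi> e = {b \<in> univ N. sat N (e(0 := b)) \<phi>}"

definition dcl :: "('f, 'r) lang \<Rightarrow> ('u, 'f, 'r) struct \<Rightarrow> 'u set \<Rightarrow> 'u set" where
  "dcl L N A = {b. \<exists>\<phi> e. param_formula L A \<phi> e \<and> solutions N \<phi> e = {b}}"

definition acl :: "('f, 'r) lang \<Rightarrow> ('u, 'f, 'r) struct \<Rightarrow> 'u set \<Rightarrow> 'u set" where
  "acl L N A = {b. \<exists>\<phi> e. param_formula L A \<phi> e \<and> finite (solutions N \<phi> e) \<and> b \<in> solutions N \<phi> e}"

text \<open>\<open>\<kappa>\<close>-saturation: every (partial) 1-type over fewer than \<open>\<kappa>\<close> parameters is realized.\<close>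

definition saturated :: "('f, 'r) lang \<Rightarrow> 'k rel \<Rightarrow> ('u, 'f, 'r) struct \<Rightarrow> bool" where
  "saturated L \<kappa> N \<longleftrightarrow>
     (\<forall>A P. A \<subseteq> univ N \<and> (card_of A, \<kappa>) \<in> ordLess \<and>
        (\<forall>(\<phi>, e)\<in>P. param_formula L A \<phi> e) \<and>
        (\<forall>Q\<subseteq>P. finite Q \<longrightarrow> (\<exists>b\<in>univ N. \<forall>(\<phi>, e)\<in>Q. b \<in> solutions N \<phi> e)) \<longrightarrow>
        (\<exists>b\<in>univ N. \<forall>(\<phi>, e)\<in>P. b \<in> solutions N \<phi> e))"

definition elementary_map ::
  "('f, 'r) lang \<Rightarrow> ('u, 'f, 'r) struct \<Rightarrow> ('u \<Rightarrow> 'u) \<Rightarrow> 'u set \<Rightarrow> bool" where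
  "elementary_map L N f A \<longleftrightarrow>
     (\<forall>\<phi> e. formula_of L \<phi> \<and> range e \<subseteq> A \<longrightarrow> (sat N e \<phi> \<longleftrightarrow> sat N (f \<circ> e) \<phi>))"

definition strong_class :: "('f, 'r) lang \<Rightarrow> ('u, 'f, 'r) struct \<Rightarrow> 'u set set \<Rightarrow> bool" where
  "strong_class L M \<K> \<longleftrightarrow>
     (\<forall>A\<in>\<K>. substruct L (M\<lparr>univ := A\<rparr>) M) \<and>
     (\<forall>A\<in>\<K>. \<forall>A'\<in>\<K>. \<forall>f. is_iso L f (M\<lparr>univ := A\<rparr>) (M\<lparr>univ := A'\<rparr>) \<longrightarrow> elementary_map L M f A)"

subsection \<open>Fields\<close>

definition ring_of :: "('u, 'f, 'r) struct \<Rightarrow> 'u ring" where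
  "ring_of N = \<lparr>carrier = univ N, monoid.mult = (\<lambda>x y. fint N FTimes [x, y]), one = fint N FOne [],
     ring.zero = fint N FZero [], add = (\<lambda>x y. fint N FPlus [x, y])\<rparr>"

text \<open>Since \<open>\<^sup>-\<^sup>1\<close> has to be total, its value at \<open>0\<close> is fixed to be \<open>0\<close>.\<close>

definition is_field_struct :: "nat \<Rightarrow> ('u, 'f, 'r) struct \<Rightarrow> bool" where
  "is_field_struct p N \<longleftrightarrow> field (ring_of N) \<and>
     (\<forall>x\<in>univ N. fint N FNeg [x] = \<ominus>\<^bsub>ring_of N\<^esub> x) \<and>
     (\<forall>x\<in>univ N. fint N FInv [x] = (if x = \<zero>\<^bsub>ring_of N\<^esub> then \<zero>\<^bsub>ring_of N\<^esub> else inv\<^bsub>ring_of N\<^esub> x)) \<and>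
     (\<forall>n::nat. [n] \<cdot>\<^bsub>ring_of N\<^esub> \<one>\<^bsub>ring_of N\<^esub> = \<zero>\<^bsub>ring_of N\<^esub> \<longleftrightarrow> p dvd n)"

primrec field_fint :: "'f fsym \<Rightarrow> 'a::field list \<Rightarrow> 'a" where
  "field_fint FZero xs = 0"
| "field_fint FOne xs = 1"
| "field_fint FPlus xs = xs ! 0 + xs ! 1"
| "field_fint FNeg xs = - (xs ! 0)"
| "field_fint FTimes xs = xs ! 0 * xs ! 1"
| "field_fint FInv xs = inverse (xs ! 0)"
| "field_fint (Fn f n) xs = 0"

text \<open>
  A field given as a type, viewed as a structure for the language of fields. The interpretations of
  the symbols outside \<^const>\<open>field_lang\<close> are irrelevant.
\<close>

definition field_struct :: "('a::field, 'f, 'r) struct" where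
  "field_struct = \<lparr>univ = UNIV, fint = field_fint, rint = (\<lambda>_ _. False)\<rparr>"

text \<open>Polynomials in HOL-Algebra are lists of coefficients, leading coefficient first.\<close>

definition formal_deriv :: "('u, 'm) ring_scheme \<Rightarrow> 'u list \<Rightarrow> 'u list" where
  "formal_deriv R q =
     ring.normalize R (map (\<lambda>i. [i] \<cdot>\<^bsub>R\<^esub> ring.coeff R q i) (rev [1..<length q]))"

definition separable_poly :: "('u, 'm) ring_scheme \<Rightarrow> 'u list \<Rightarrow> bool" where
  "separable_poly R q \<longleftrightarrow>
     (\<forall>d \<in> carrier (poly_ring R). d divides\<^bsub>poly_ring R\<^esub> q \<and> d divides\<^bsub>poly_ring R\<^esub> formal_deriv R q
        \<longrightarrow> d \<in> Units (poly_ring R))"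

definition separably_closed :: "('u, 'm) ring_scheme \<Rightarrow> bool" where
  "separably_closed R \<longleftrightarrow> field R \<and>
     (\<forall>q \<in> carrier (poly_ring R). Polynomials.degree q > 0 \<and> separable_poly R q \<longrightarrow>
        (\<exists>x \<in> carrier R. ring.eval R q x = \<zero>\<^bsub>R\<^esub>))"

definition linearly_disjoint ::
  "('u, 'm) ring_scheme \<Rightarrow> 'u set \<Rightarrow> 'u set \<Rightarrow> 'u set \<Rightarrow> bool" where
  "linearly_disjoint R K E k \<longleftrightarrow>
     (\<forall>us. set us \<subseteq> K \<and> ring.independent R k us \<longrightarrow> ring.independent R E us)"

text \<open>\<open>F/K\<close> is separable, where \<open>F\<close> has characteristic \<open>p\<close> and \<open>K\<close> is a subfield of \<open>F\<close>.\<close>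

definition separable_extension :: "nat \<Rightarrow> ('u, 'm) ring_scheme \<Rightarrow> 'u set \<Rightarrow> bool" where
  "separable_extension p F K \<longleftrightarrow>
     p = 0 \<or> linearly_disjoint F K ((\<lambda>x. x [^]\<^bsub>F\<^esub> p) ` carrier F) ((\<lambda>x. x [^]\<^bsub>F\<^esub> p) ` K)"

end

theory Submission imports Defs begin

text \<open>
  Let \<open>B = acl\<^sub>L(A) = acl\<^sub>0(A) \<inter> M\<close>. It is definably closed, so it lies in \<open>\<K>\<close>. Since \<open>M/A\<close> is separable,
  every element of \<open>B\<close> has a separable minimal polynomial over \<open>A\<close>, and since \<open>M\<close> is separably closed all
  its roots lie in \<open>B\<close>; so \<open>B/A\<close> is Galois. If \<open>b \<in> B - A\<close>, then \<open>b\<close> has a conjugate \<open>b' \<noteq> b\<close> over \<open>A\<close>,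
  and some automorphism of \<open>B\<close> over \<open>A\<close> sends \<open>b\<close> to \<open>b'\<close>. By Hypothesis 3 it is an \<open>L\<close>-isomorphism and by
  strength it is elementary, so \<open>b \<notin> dcl\<^sub>L(A)\<close>. In \<open>M\<^sub>0\<close> a back-and-forth argument shows that conjugate
  elements satisfy the same formulas over \<open>A\<close>, so \<open>b \<notin> dcl\<^sub>0(A)\<close>. The same argument, applied to the
  powers of a transcendental element, shows that \<open>acl\<^sub>0(A)\<close> is algebraic over \<open>A\<close>.
\<close>

section \<open>Isomorphisms between subfields\<close>

text \<open>The set \<open>A\<close> may be as large as \<open>M\<close>, so saturation need not
  provide automorphisms over \<open>A\<close>. Two devices get around this. The automorphism is
  built on \<open>B\<close> alone, where every element is algebraic over \<open>A\<close>: each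
  one-step extension only needs a root of a polynomial, and Zorn's lemma does the rest. In
  \<open>M0\<close> a valuation has only countably many values, so before each quantifier step the
  isomorphism at hand is cut down to the subfields generated by the two valuations. Their size is
  bounded by the number of terms, and saturation can supply a transcendental image whenever one is
  required.\<close>

definition subfield_set :: "'a::field set \<Rightarrow> bool" where
  "subfield_set A \<longleftrightarrow> 0 \<in> A \<and> 1 \<in> A \<and> (\<forall>x\<in>A. \<forall>y\<in>A. x + y \<in> A \<and> x * y \<in> A) \<and>
     (\<forall>x\<in>A. - x \<in> A \<and> inverse x \<in> A)"

text \<open>
  The graph of an isomorphism between two subfields of the ambient field. Working with graphs
  makes the inverse isomorphism the converse relation and avoids mapping polynomials.
\<close>

definition field_corr :: "('a::field \<times> 'a) set \<Rightarrow> bool" where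
  "field_corr G \<longleftrightarrow> (0, 0) \<in> G \<and> (1, 1) \<in> G \<and>
     (\<forall>(x, y)\<in>G. \<forall>(x', y')\<in>G. (x + x', y + y') \<in> G \<and> (x * x', y * y') \<in> G) \<and>
     (\<forall>(x, y)\<in>G. (- x, - y) \<in> G \<and> (inverse x, inverse y) \<in> G \<and> (x = 0 \<longleftrightarrow> y = 0))"

lemma field_corrD:
  assumes "field_corr G"
  shows field_corr_0: "(0, 0) \<in> G" and field_corr_1: "(1, 1) \<in> G"
    and field_corr_add: "(x, y) \<in> G \<Longrightarrow> (x', y') \<in> G \<Longrightarrow> (x + x', y + y') \<in> G"
    and field_corr_mult: "(x, y) \<in> G \<Longrightarrow> (x', y') \<in> G \<Longrightarrow> (x * x', y * y') \<in> G"
    and field_corr_minus: "(x, y) \<in> G \<Longrightarrow> (- x, - y) \<in> G"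
    and field_corr_inverse: "(x, y) \<in> G \<Longrightarrow> (inverse x, inverse y) \<in> G"
    and field_corr_zero: "(x, y) \<in> G \<Longrightarrow> x = 0 \<longleftrightarrow> y = 0"
  using assms unfolding field_corr_def by auto

lemma field_corrI:
  assumes "(0, 0) \<in> G" "(1, 1) \<in> G"
    and "\<And>x y x' y'. (x, y) \<in> G \<Longrightarrow> (x', y') \<in> G \<Longrightarrow> (x + x', y + y') \<in> G \<and> (x * x', y * y') \<in> G"
    and "\<And>x y. (x, y) \<in> G \<Longrightarrow> (- x, - y) \<in> G \<and> (inverse x, inverse y) \<in> G \<and> (x = 0 \<longleftrightarrow> y = 0)"
  shows "field_corr G"
  unfolding field_corr_def using assms by blast

lemma field_corr_diff:
  "field_corr G \<Longrightarrow> (x, y) \<in> G \<Longrightarrow> (x', y') \<in> G \<Longrightarrow> (x - x', y - y') \<in> G"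
  using field_corr_add[of G x y "- x'" "- y'"] field_corr_minus[of G x' y'] by simp

lemma field_corr_power: "field_corr G \<Longrightarrow> (x, y) \<in> G \<Longrightarrow> (x ^ n, y ^ n) \<in> G"
  by (induction n) (auto simp: field_corr_1 field_corr_mult)

lemma field_corr_sum:
  "field_corr G \<Longrightarrow> (\<And>i. i \<in> I \<Longrightarrow> (f i, g i) \<in> G) \<Longrightarrow> (sum f I, sum g I) \<in> G"
  by (induction I rule: infinite_finite_induct) (auto simp: field_corr_0 field_corr_add)

text \<open>The clause on zeros, applied to differences, makes the relation single-valued and
  injective at once.\<close>

lemma field_corr_unique:
  assumes "field_corr G" "(x, y) \<in> G" "(x', y') \<in> G"
  shows "x = x' \<longleftrightarrow> y = y'"
  using field_corr_zero[OF assms(1) field_corr_diff[OF assms]] by simp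

lemma field_corr_converse: "field_corr G \<Longrightarrow> field_corr (G\<inverse>)"
  by (simp add: field_corr_def Ball_def)

lemma field_corr_Id_on: "subfield_set A \<Longrightarrow> field_corr (Id_on A)"
  unfolding field_corr_def subfield_set_def by (auto simp: Id_on_def)

section \<open>Polynomials with corresponding coefficients\<close>

definition poly_pair :: "('a::field \<times> 'a) set \<Rightarrow> 'a poly \<Rightarrow> 'a poly \<Rightarrow> bool" where
  "poly_pair G p q \<longleftrightarrow> (\<forall>i. (coeff p i, coeff q i) \<in> G)"

lemma poly_pair_0: "field_corr G \<Longrightarrow> poly_pair G 0 0"
  by (simp add: poly_pair_def field_corr_0)

lemma poly_pair_add:
  "field_corr G \<Longrightarrow> poly_pair G p q \<Longrightarrow> poly_pair G p' q' \<Longrightarrow> poly_pair G (p + p') (q + q')"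
  by (simp add: poly_pair_def field_corr_add)

lemma poly_pair_diff:
  "field_corr G \<Longrightarrow> poly_pair G p q \<Longrightarrow> poly_pair G p' q' \<Longrightarrow> poly_pair G (p - p') (q - q')"
  by (simp add: poly_pair_def field_corr_diff)

lemma poly_pair_uminus:
  "field_corr G \<Longrightarrow> poly_pair G p q \<Longrightarrow> poly_pair G (- p) (- q)"
  by (simp add: poly_pair_def field_corr_minus)

lemma poly_pair_mult:
  "field_corr G \<Longrightarrow> poly_pair G p q \<Longrightarrow> poly_pair G p' q' \<Longrightarrow> poly_pair G (p * p') (q * q')"
  by (simp add: poly_pair_def coeff_mult field_corr_sum field_corr_mult)

lemma poly_pair_smult:
  "field_corr G \<Longrightarrow> (a, b) \<in> G \<Longrightarrow> poly_pair G p q \<Longrightarrow>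
     poly_pair G (smult a p) (smult b q)"
  by (simp add: poly_pair_def field_corr_mult)

lemma poly_pair_monom:
  "field_corr G \<Longrightarrow> (a, b) \<in> G \<Longrightarrow> poly_pair G (monom a n) (monom b n)"
  by (simp add: poly_pair_def field_corr_0)

lemma poly_pair_pCons:
  "field_corr G \<Longrightarrow> (a, b) \<in> G \<Longrightarrow> poly_pair G p q \<Longrightarrow> poly_pair G (pCons a p) (pCons b q)"
  by (auto simp: poly_pair_def coeff_pCons split: nat.split)

lemma field_corr_of_nat_mult:
  "field_corr G \<Longrightarrow> (a, b) \<in> G \<Longrightarrow> (of_nat n * a, of_nat n * b) \<in> G"
  by (induction n) (auto simp: field_corr_0 field_corr_add algebra_simps)

lemma poly_pair_pderiv:
  "field_corr G \<Longrightarrow> poly_pair G p q \<Longrightarrow> poly_pair G (pderiv p) (pderiv q)"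
  unfolding poly_pair_def coeff_pderiv using field_corr_of_nat_mult by blast

lemma poly_pair_eq_0: "field_corr G \<Longrightarrow> poly_pair G p q \<Longrightarrow> p = 0 \<longleftrightarrow> q = 0"
  unfolding poly_pair_def poly_eq_iff using field_corr_zero by fastforce

lemma poly_pair_degree:
  assumes "field_corr G" "poly_pair G p q"
  shows "degree p = degree q"
proof -
  have "coeff p i = 0 \<longleftrightarrow> coeff q i = 0" for i
    using assms field_corr_zero unfolding poly_pair_def by blast
  then show ?thesis unfolding Polynomial.degree_def by simp
qed

lemma poly_pair_poly:
  assumes "field_corr G" "(c, d) \<in> G" "poly_pair G p q"
  shows "(poly p c, poly q d) \<in> G"
proof -
  have "(coeff p i * c ^ i, coeff q i * d ^ i) \<in> G" for i
    using assms by (simp add: poly_pair_def field_corr_mult field_corr_power)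
  then show ?thesis
    unfolding poly_altdef poly_pair_degree[OF assms(1,3)] by (intro field_corr_sum assms)
qed

lemma poly_pair_converse: "poly_pair (G\<inverse>) p q \<longleftrightarrow> poly_pair G q p"
  by (simp add: poly_pair_def)

lemma poly_pair_mono: "G \<subseteq> H \<Longrightarrow> poly_pair G p q \<Longrightarrow> poly_pair H p q"
  by (auto simp: poly_pair_def)

text \<open>Through this the calculus of pairs specializes to polynomials over the subfield
  \<open>A\<close>.\<close>

lemma poly_pair_Id_on:
  "poly_pair (Id_on A) p q \<longleftrightarrow> p = q \<and> (\<forall>i. coeff p i \<in> A)"
  by (auto simp: poly_pair_def poly_eq_iff Id_on_iff)

lemma poly_pair_division:
  assumes G: "field_corr G" and m: "poly_pair G m1 m2" and lead: "lead_coeff m1 = 1"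
    and p: "poly_pair G p1 p2"
  obtains q1 q2 r1 r2 where "poly_pair G q1 q2" "poly_pair G r1 r2"
    "p1 = m1 * q1 + r1" "p2 = m2 * q2 + r2"
    "r1 = 0 \<or> degree r1 < degree m1"
proof -
  have "\<exists>q1 q2 r1 r2. poly_pair G q1 q2 \<and> poly_pair G r1 r2 \<and>
    p1 = m1 * q1 + r1 \<and> p2 = m2 * q2 + r2 \<and>
    (r1 = 0 \<or> degree r1 < degree m1)"
    using p
  \<comment> \<open>The measure puts the zero polynomial strictly below the nonzero constants, which
    \<open>degree\<close> alone does not; this matters when \<open>m1\<close> is constant.\<close>
  proof (induction "if p1 = 0 then 0 else Suc (degree p1)" arbitrary: p1 p2
      rule: less_induct)
    case less
    show ?case
    proof (cases "p1 = 0 \<or> degree p1 < degree m1")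
      case True
      then show ?thesis
        using less.prems G poly_pair_0 by (intro exI[of _ 0] exI[of _ p1] exI[of _ p2]) auto
    next
      case False
      \<comment> \<open>Reading \<open>b\<close> off at index \<open>degree p1\<close>, which is
        also the degree of \<open>p2\<close>, makes \<open>(a, b) \<in> G\<close> immediate.\<close>
      define a b n where "a = lead_coeff p1"
        and "b = coeff p2 (degree p1)"
        and "n = degree p1 - degree m1"
      have ab: "(a, b) \<in> G" using less.prems by (simp add: poly_pair_def a_def b_def)
      have mon: "poly_pair G (monom a n) (monom b n)"
        using G ab by (rule poly_pair_monom)
      let ?p1 = "p1 - m1 * monom a n" and ?p2 = "p2 - m2 * monom b n"
      have pp: "poly_pair G ?p1 ?p2"
        using G less.prems m mon by (intro poly_pair_diff poly_pair_mult)
      have "a \<noteq> 0" "m1 \<noteq> 0" using False lead by (auto simp: a_def)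
      then have deg: "degree (m1 * monom a n) = degree p1"
        using False by (simp add: degree_mult_eq degree_monom_eq n_def)
      have "?p1 = 0 \<or> degree ?p1 < degree p1"
      proof (rule ccontr)
        assume "\<not> (?p1 = 0 \<or> degree ?p1 < degree p1)"
        then have *: "?p1 \<noteq> 0" "degree ?p1 = degree p1"
          using deg degree_diff_le[of p1 "degree p1" "m1 * monom a n"] by auto
        have "coeff (m1 * monom a n) (degree p1) = a"
          using lead_coeff_mult[of m1 "monom a n"] deg lead \<open>a \<noteq> 0\<close>
          by (simp add: degree_monom_eq)
        then have "lead_coeff ?p1 = 0" using * by (simp add: a_def)
        with * show False using leading_coeff_0_iff by blast
      qed
      then have less: "(if ?p1 = 0 then 0 else Suc (degree ?p1)) < (if p1 = 0 then 0 else Suc (degree p1))"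
        using False by auto
      then obtain q1 q2 r1 r2 where "poly_pair G q1 q2" "poly_pair G r1 r2"
        "?p1 = m1 * q1 + r1" "?p2 = m2 * q2 + r2"
        "r1 = 0 \<or> degree r1 < degree m1"
        using less.hyps[OF less pp] by blast
      then show ?thesis
        using poly_pair_add[OF G _ mon, of q1 q2]
        by (intro exI[of _ "q1 + monom a n"] exI[of _ "q2 + monom b n"]
            exI[of _ r1] exI[of _ r2]) (simp add: algebra_simps)
    qed
  qed
  then show ?thesis using that by blast
qed

text \<open>
  \<open>m1\<close> is the minimal polynomial of \<open>c\<close> over the domain of \<open>G\<close>, and \<open>m2\<close> its image under \<open>G\<close>.
\<close>

definition min_pair :: "('a::field \<times> 'a) set \<Rightarrow> 'a \<Rightarrow> 'a poly \<Rightarrow> 'a poly \<Rightarrow> bool" where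
  "min_pair G c m1 m2 \<longleftrightarrow> poly_pair G m1 m2 \<and> lead_coeff m1 = 1 \<and> poly m1 c = 0 \<and>
     (\<forall>p q. poly_pair G p q \<and> poly p c = 0 \<and> p \<noteq> 0 \<longrightarrow> degree m1 \<le> degree p)"

lemma min_pair_exists:
  assumes G: "field_corr G" and p: "poly_pair G p q" "p \<noteq> 0" "poly p c = 0"
  obtains m1 m2 where "min_pair G c m1 m2"
proof -
  let ?P = "\<lambda>n. \<exists>p q. poly_pair G p q \<and> poly p c = 0 \<and> p \<noteq> 0 \<and> degree p = n"
  have ex: "?P (degree p)" using p by blast
  define n where "n = (LEAST n. ?P n)"
  obtain p1 p2 where pp: "poly_pair G p1 p2" "poly p1 c = 0" "p1 \<noteq> 0" "degree p1 = n"
    using LeastI[of ?P, OF ex] unfolding n_def by blast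
  define a b where "a = inverse (lead_coeff p1)"
    and "b = inverse (coeff p2 (degree p1))"
  have "(a, b) \<in> G"
    using G pp(1) by (auto simp: a_def b_def poly_pair_def intro: field_corr_inverse)
  then have "poly_pair G (smult a p1) (smult b p2)"
    using G pp(1) by (intro poly_pair_smult)
  moreover have "a \<noteq> 0" "lead_coeff (smult a p1) = 1" using pp(3) by (auto simp: a_def)
  moreover have "degree p1 \<le> degree p" if "poly_pair G p q" "poly p c = 0" "p \<noteq> 0" for p q
  proof -
    have "?P (degree p)" using that by blast
    then show ?thesis using Least_le[of ?P "degree p"] pp(4) unfolding n_def by simp
  qed
  ultimately show ?thesis
    using pp(2) by (intro that[of "smult a p1" "smult b p2"]) (auto simp: min_pair_def)
qed

lemma min_pairD:
  assumes "min_pair G c m1 m2"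
  shows "poly_pair G m1 m2" "lead_coeff m1 = 1" "poly m1 c = 0" "m1 \<noteq> 0"
    "\<And>p q. poly_pair G p q \<Longrightarrow> poly p c = 0 \<Longrightarrow> p \<noteq> 0 \<Longrightarrow> degree m1 \<le> degree p"
  using assms unfolding min_pair_def by auto

lemma min_pair_degree_pos: "min_pair G c m1 m2 \<Longrightarrow> degree m1 > 0"
proof (rule ccontr)
  assume m: "min_pair G c m1 m2" and "\<not> degree m1 > 0"
  then obtain a where "m1 = [:a:]" by (auto elim: degree_eq_zeroE)
  then show False using min_pairD(2,3)[OF m] by simp
qed

text \<open>Both sides are divided simultaneously. The remainder vanishes on the first side by
  minimality, hence also on the second.\<close>

lemma min_pair_dvd:
  assumes G: "field_corr G" and m: "min_pair G c m1 m2" and p: "poly_pair G p1 p2" "poly p1 c = 0"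
  obtains q1 q2 where "poly_pair G q1 q2" "p1 = m1 * q1" "p2 = m2 * q2"
proof -
  note mD = min_pairD[OF m]
  obtain q1 q2 r1 r2 where *: "poly_pair G q1 q2" "poly_pair G r1 r2"
    "p1 = m1 * q1 + r1" "p2 = m2 * q2 + r2"
    "r1 = 0 \<or> degree r1 < degree m1"
    using poly_pair_division[OF G mD(1,2) p(1)] .
  have "poly r1 c = 0" using * mD(3) p(2) by simp
  then have "r1 = 0" using mD(5)[OF *(2)] *(5) by fastforce
  then have "r2 = 0" using poly_pair_eq_0[OF G *(2)] by simp
  with \<open>r1 = 0\<close> * show ?thesis using that by simp
qed

text \<open>
  Exactly the condition under which the isomorphism \<open>G\<close> extends to one sending \<open>c\<close> to \<open>d\<close>.
\<close>

definition conjugate :: "('a::field \<times> 'a) set \<Rightarrow> 'a \<Rightarrow> 'a \<Rightarrow> bool" where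
  "conjugate G c d \<longleftrightarrow> (\<forall>p q. poly_pair G p q \<longrightarrow> (poly p c = 0 \<longleftrightarrow> poly q d = 0))"

text \<open>From \<open>p\<close> to \<open>q\<close> this is divisibility by the minimal
  polynomial. For the converse let \<open>n2\<close> be the minimal polynomial of \<open>d\<close>
  over the range of \<open>G\<close>. It divides \<open>m2\<close>, so its preimage
  \<open>n1\<close> divides \<open>m1\<close>; the cofactor has smaller degree than
  \<open>m1\<close> and cannot kill \<open>c\<close>, so \<open>n1\<close> kills \<open>c\<close>.
  Irreducibility never has to be formulated.\<close>

lemma min_pair_conjugate:
  assumes G: "field_corr G" and m: "min_pair G c m1 m2" and d: "poly m2 d = 0"
  shows "conjugate G c d"
  unfolding conjugate_def
proof (intro allI impI iffI)
  note mD = min_pairD[OF m]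
  fix p q assume pq: "poly_pair G p q"
  {
    assume "poly p c = 0"
    then obtain q2 where "q = m2 * q2" using min_pair_dvd[OF G m pq] by metis
    then show "poly q d = 0" using d by simp
  }
  assume q: "poly q d = 0"
  note G' = field_corr_converse[OF G]
  have "m2 \<noteq> 0" using mD(1,4) poly_pair_eq_0[OF G] by blast
  then obtain n2 n1 where n: "min_pair (G\<inverse>) d n2 n1"
    using min_pair_exists[OF G', of m2 m1 d] mD(1) d by (auto simp: poly_pair_converse)
  obtain q2 q1 where qq: "poly_pair G q1 q2" "m2 = n2 * q2" "m1 = n1 * q1"
    using min_pair_dvd[OF G' n, of m2 m1] mD(1) d unfolding poly_pair_converse by metis
  have n': "poly_pair G n1 n2" using min_pairD(1)[OF n] by (simp add: poly_pair_converse)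
  have nz: "n1 \<noteq> 0" "q1 \<noteq> 0" using mD(4) qq by auto
  have "degree n1 > 0"
    using min_pair_degree_pos[OF n] poly_pair_degree[OF G n'] by simp
  then have "degree q1 < degree m1" using nz qq(3) by (simp add: degree_mult_eq)
  then have "poly q1 c \<noteq> 0" using mD(5)[OF qq(1)] nz by fastforce
  then have "poly n1 c = 0" using mD(3) qq(3) by simp
  moreover obtain s2 s1 where "p = n1 * s1"
    using min_pair_dvd[OF G' n, of q p] pq q unfolding poly_pair_converse by metis
  ultimately show "poly p c = 0" by simp
qed

text \<open>Fractions rather than polynomial values, so that algebraic and transcendental
  \<open>c\<close> are treated alike. That the second denominator is nonzero follows from
  \<open>conjugate G c d\<close>.\<close>

definition adjoin :: "('a::field \<times> 'a) set \<Rightarrow> 'a \<Rightarrow> 'a \<Rightarrow> ('a \<times> 'a) set" where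
  "adjoin G c d = {(poly p1 c / poly q1 c, poly p2 d / poly q2 d) | p1 p2 q1 q2.
     poly_pair G p1 p2 \<and> poly_pair G q1 q2 \<and> poly q1 c \<noteq> 0}"

lemma adjoinI:
  "poly_pair G p1 p2 \<Longrightarrow> poly_pair G q1 q2 \<Longrightarrow> poly q1 c \<noteq> 0 \<Longrightarrow> x = poly p1 c / poly q1 c \<Longrightarrow>
    y = poly p2 d / poly q2 d \<Longrightarrow> (x, y) \<in> adjoin G c d"
  unfolding adjoin_def by blast

lemma adjoin_superset:
  assumes "field_corr G"
  shows "G \<subseteq> adjoin G c d" "(c, d) \<in> adjoin G c d"
proof -
  have 1: "poly_pair G [:1:] [:1:]" "poly_pair G [:0, 1:] [:0, 1:]"
    using assms by (intro poly_pair_pCons poly_pair_0 field_corr_0 field_corr_1; simp)+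
  show "(c, d) \<in> adjoin G c d" by (rule adjoinI[OF 1(2,1)]) auto
  show "G \<subseteq> adjoin G c d"
  proof (rule subrelI)
    fix x y assume "(x, y) \<in> G"
    then have "poly_pair G [:x:] [:y:]" using assms by (intro poly_pair_pCons poly_pair_0)
    then show "(x, y) \<in> adjoin G c d" by (rule adjoinI[OF _ 1(1)]) auto
  qed
qed

lemma field_corr_adjoin:
  assumes G: "field_corr G" and conj: "conjugate G c d"
  shows "field_corr (adjoin G c d)"
proof -
  have nz: "poly p c = 0 \<longleftrightarrow> poly q d = 0" if "poly_pair G p q" for p q
    using conj that unfolding conjugate_def by blast
  have add: "(x + x', y + y') \<in> adjoin G c d \<and> (x * x', y * y') \<in> adjoin G c d"
    if xy: "(x, y) \<in> adjoin G c d" and xy': "(x', y') \<in> adjoin G c d" for x y x' y'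
  proof -
    obtain p1 p2 q1 q2 where *: "poly_pair G p1 p2" "poly_pair G q1 q2" "poly q1 c \<noteq> 0"
      "x = poly p1 c / poly q1 c" "y = poly p2 d / poly q2 d" using xy unfolding adjoin_def by blast
    obtain r1 r2 s1 s2 where **: "poly_pair G r1 r2" "poly_pair G s1 s2" "poly s1 c \<noteq> 0"
      "x' = poly r1 c / poly s1 c" "y' = poly r2 d / poly s2 d" using xy' unfolding adjoin_def by blast
    have nz': "poly q2 d \<noteq> 0" "poly s2 d \<noteq> 0" using * ** nz by blast+
    have "(x + x', y + y') \<in> adjoin G c d"
      by (rule adjoinI[where ?p1.0 = "p1 * s1 + r1 * q1" and ?p2.0 = "p2 * s2 + r2 * q2"
            and ?q1.0 = "q1 * s1" and ?q2.0 = "q2 * s2"])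
        (use * ** nz' G in \<open>auto intro!: poly_pair_add poly_pair_mult simp: add_frac_eq\<close>)
    moreover have "(x * x', y * y') \<in> adjoin G c d"
      by (rule adjoinI[where ?p1.0 = "p1 * r1" and ?p2.0 = "p2 * r2"
            and ?q1.0 = "q1 * s1" and ?q2.0 = "q2 * s2"])
        (use * ** nz' G in \<open>auto intro!: poly_pair_mult\<close>)
    ultimately show ?thesis by blast
  qed
  have inv: "(- x, - y) \<in> adjoin G c d \<and> (inverse x, inverse y) \<in> adjoin G c d \<and> (x = 0 \<longleftrightarrow> y = 0)"
    if xy: "(x, y) \<in> adjoin G c d" for x y
  proof -
    obtain p1 p2 q1 q2 where *: "poly_pair G p1 p2" "poly_pair G q1 q2" "poly q1 c \<noteq> 0"
      "x = poly p1 c / poly q1 c" "y = poly p2 d / poly q2 d" using xy unfolding adjoin_def by blast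
    have nz': "poly q2 d \<noteq> 0" "poly p1 c = 0 \<longleftrightarrow> poly p2 d = 0" using * nz by blast+
    have "(- x, - y) \<in> adjoin G c d"
      by (rule adjoinI[where ?p1.0 = "- p1" and ?p2.0 = "- p2" and ?q1.0 = q1 and ?q2.0 = q2])
        (use * G in \<open>auto intro!: poly_pair_uminus\<close>)
    moreover have "(inverse x, inverse y) \<in> adjoin G c d"
    proof (cases "poly p1 c = 0")
      \<comment> \<open>Here \<open>x = 0\<close>, so the fraction cannot be turned over, but
        \<open>inverse 0 = 0\<close> and the pair \<open>(0, 0)\<close> is in
        \<open>G\<close>.\<close>
      case True
      then show ?thesis using *(4,5) nz' adjoin_superset(1)[OF G] field_corr_0[OF G] by auto
    next
      case False
      then show ?thesis
        by (intro adjoinI[where ?p1.0 = q1 and ?p2.0 = q2 and ?q1.0 = p1 and ?q2.0 = p2])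
          (use * in auto)
    qed
    ultimately show ?thesis using * nz' by auto
  qed
  show ?thesis
    using add inv adjoin_superset(1)[OF G, of c d] field_corr_0[OF G] field_corr_1[OF G]
    unfolding field_corr_def by blast
qed

section \<open>Model-theoretic algebraic closure\<close>

lemma tm_val_cong: "(\<And>x. x \<in> tm_vars t \<Longrightarrow> e x = e' x) \<Longrightarrow> tm_val N e t = tm_val N e' t"
proof (induction t)
  case (TApp s ts)
  then have "map (tm_val N e) ts = map (tm_val N e') ts" by auto
  then show ?case by (simp del: map_eq_conv)
qed simp

lemma sat_cong: "(\<And>x. x \<in> free_vars \<phi> \<Longrightarrow> e x = e' x) \<Longrightarrow> sat N e \<phi> \<longleftrightarrow> sat N e' \<phi>"
proof (induction \<phi> arbitrary: e e')
  case (FEq t u)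
  then show ?case using tm_val_cong[of t e e' N] tm_val_cong[of u e e' N] by simp
next
  case (FRel R ts)
  then have "map (tm_val N e) ts = map (tm_val N e') ts" by (auto intro!: tm_val_cong)
  then show ?case by (simp del: map_eq_conv)
next
  case (FNot \<phi>)
  have "sat N e \<phi> \<longleftrightarrow> sat N e' \<phi>" using FNot.prems by (intro FNot.IH) simp
  then show ?case by simp
next
  case (FAnd \<phi> \<psi>)
  have "sat N e \<phi> \<longleftrightarrow> sat N e' \<phi>" "sat N e \<psi> \<longleftrightarrow> sat N e' \<psi>"
    using FAnd.prems by (intro FAnd.IH; simp)+
  then show ?case by simp
next
  case (FEx x \<phi>)
  have "sat N (e(x := a)) \<phi> \<longleftrightarrow> sat N (e'(x := a)) \<phi>" for a
    using FEx.prems by (intro FEx.IH) auto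
  then show ?case by simp
qed

lemma finite_tm_vars: "finite (tm_vars t)"
  by (induction t) auto

lemma finite_free_vars: "finite (free_vars \<phi>)"
  by (induction \<phi>) (auto simp: finite_tm_vars)

fun rename_tm :: "(nat \<Rightarrow> nat) \<Rightarrow> 'f tm \<Rightarrow> 'f tm" where
  "rename_tm \<rho> (TVar x) = TVar (\<rho> x)"
| "rename_tm \<rho> (TApp s ts) = TApp s (map (rename_tm \<rho>) ts)"

fun rename_fm :: "(nat \<Rightarrow> nat) \<Rightarrow> ('f, 'r) fm \<Rightarrow> ('f, 'r) fm" where
  "rename_fm \<rho> (FEq t u) = FEq (rename_tm \<rho> t) (rename_tm \<rho> u)"
| "rename_fm \<rho> (FRel R ts) = FRel R (map (rename_tm \<rho>) ts)"
| "rename_fm \<rho> (FNot \<phi>) = FNot (rename_fm \<rho> \<phi>)"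
| "rename_fm \<rho> (FAnd \<phi> \<psi>) = FAnd (rename_fm \<rho> \<phi>) (rename_fm \<rho> \<psi>)"
| "rename_fm \<rho> (FEx x \<phi>) = FEx (\<rho> x) (rename_fm \<rho> \<phi>)"

lemma tm_val_rename: "tm_val N e (rename_tm \<rho> t) = tm_val N (e \<circ> \<rho>) t"
proof (induction t)
  case (TApp s ts)
  then have "map (tm_val N e) (map (rename_tm \<rho>) ts) = map (tm_val N (e \<circ> \<rho>)) ts"
    by (auto simp: comp_def)
  then show ?case by (simp add: comp_def del: map_map map_eq_conv)
qed simp

lemma term_of_rename: "term_of L t \<Longrightarrow> term_of L (rename_tm \<rho> t)"
  by (induction t) auto

lemma tm_vars_rename: "tm_vars (rename_tm \<rho> t) = \<rho> ` tm_vars t"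
  by (induction t) auto

lemma formula_of_rename: "formula_of L \<phi> \<Longrightarrow> formula_of L (rename_fm \<rho> \<phi>)"
  by (induction \<phi>) (auto simp: term_of_rename)

lemma free_vars_rename: "inj \<rho> \<Longrightarrow> free_vars (rename_fm \<rho> \<phi>) = \<rho> ` free_vars \<phi>"
  by (induction \<phi>) (auto simp: tm_vars_rename image_Un image_UN image_set_diff)

lemma sat_rename: "inj \<rho> \<Longrightarrow> sat N e (rename_fm \<rho> \<phi>) \<longleftrightarrow> sat N (e \<circ> \<rho>) \<phi>"
proof (induction \<phi> arbitrary: e)
  case (FRel R ts)
  have "map (tm_val N e) (map (rename_tm \<rho>) ts) = map (tm_val N (e \<circ> \<rho>)) ts"
    by (simp add: tm_val_rename)
  then show ?case by (simp add: comp_def del: map_map map_eq_conv)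
next
  case (FEx x \<phi>)
  then have "(e(\<rho> x := a)) \<circ> \<rho> = (e \<circ> \<rho>)(x := a)" for a by (auto simp: fun_eq_iff dest: injD)
  then show ?case by (simp only: sat.simps rename_fm.simps FEx.IH[OF FEx.prems])
qed (simp_all add: tm_val_rename)

section \<open>Bounding the number of solutions by a formula\<close>

lemma fresh_var_exists: "\<exists>y. y \<noteq> 0 \<and> y \<notin> free_vars \<phi>"
  using ex_new_if_finite[of "insert 0 (free_vars \<phi>)"] finite_free_vars[of \<phi>] infinite_UNIV_nat
  by auto

definition fresh_var :: "('f, 'r) fm \<Rightarrow> nat" where
  "fresh_var \<phi> = (SOME y. y \<noteq> 0 \<and> y \<notin> free_vars \<phi>)"

lemma fresh_var: "fresh_var \<phi> \<noteq> 0" "fresh_var \<phi> \<notin> free_vars \<phi>"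
  using someI_ex[OF fresh_var_exists[of \<phi>]] unfolding fresh_var_def by auto

text \<open>The recursion names one candidate solution by a fresh variable and counts the others;
  variable 0 keeps its role as the solution variable throughout.\<close>

primrec at_most :: "nat \<Rightarrow> ('f, 'r) fm \<Rightarrow> ('f, 'r) fm" where
  "at_most 0 \<phi> = FNot (FEx 0 \<phi>)"
| "at_most (Suc k) \<phi> = FEx (fresh_var \<phi>) (at_most k (FAnd \<phi> (FNot (FEq (TVar 0) (TVar (fresh_var \<phi>))))))"

lemma formula_of_at_most: "formula_of L \<phi> \<Longrightarrow> formula_of L (at_most k \<phi>)"
  by (induction k arbitrary: \<phi>) auto

lemma free_vars_at_most: "free_vars (at_most k \<phi>) = free_vars \<phi> - {0}"
proof (induction k arbitrary: \<phi>)
  case (Suc k)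
  then show ?case using fresh_var[of \<phi>] by auto
qed simp

lemma solutions_cong:
  "(\<And>x. x \<in> free_vars \<phi> - {0} \<Longrightarrow> e x = e' x) \<Longrightarrow> solutions N \<phi> e = solutions N \<phi> e'"
proof -
  assume *: "\<And>x. x \<in> free_vars \<phi> - {0} \<Longrightarrow> e x = e' x"
  have "sat N (e(0 := b)) \<phi> \<longleftrightarrow> sat N (e'(0 := b)) \<phi>" for b using * by (intro sat_cong) auto
  then show ?thesis unfolding solutions_def by blast
qed

lemma sat_at_most:
  assumes "univ N \<noteq> {}"
  shows "sat N e (at_most k \<phi>) \<longleftrightarrow> finite (solutions N \<phi> e) \<and> card (solutions N \<phi> e) \<le> k"
proof (induction k arbitrary: \<phi> e)
  case 0
  have "finite (solutions N \<phi> e) \<and> card (solutions N \<phi> e) \<le> 0 \<longleftrightarrow> solutions N \<phi> e = {}" by auto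
  then show ?case by (auto simp: solutions_def)
next
  case (Suc k)
  let ?y = "fresh_var \<phi>"
  let ?\<psi> = "FAnd \<phi> (FNot (FEq (TVar 0) (TVar ?y)))"
  let ?S = "solutions N \<phi> e"
  have S: "solutions N ?\<psi> (e(?y := a)) = ?S - {a}" for a
  proof -
    have "solutions N \<phi> (e(?y := a)) = ?S" using fresh_var(2)[of \<phi>] by (intro solutions_cong) auto
    moreover have "solutions N ?\<psi> (e(?y := a)) = solutions N \<phi> (e(?y := a)) - {a}"
      using fresh_var(1)[of \<phi>] by (auto simp: solutions_def)
    ultimately show ?thesis by simp
  qed
  have "sat N e (at_most (Suc k) \<phi>) \<longleftrightarrow> (\<exists>a\<in>univ N. finite (?S - {a}) \<and> card (?S - {a}) \<le> k)"
    by (simp only: sat.simps at_most.simps Suc.IH S)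
  also have "\<dots> \<longleftrightarrow> finite ?S \<and> card ?S \<le> Suc k"
  proof (cases "?S = {}")
    \<comment> \<open>The outer quantifier needs a witness even though nothing has to be removed;
      this is where the universe must be nonempty.\<close>
    case True
    then show ?thesis using assms by auto
  next
    case False
    then obtain b where b: "b \<in> ?S" "b \<in> univ N" by (auto simp: solutions_def)
    show ?thesis
    proof
      assume "\<exists>a\<in>univ N. finite (?S - {a}) \<and> card (?S - {a}) \<le> k"
      then show "finite ?S \<and> card ?S \<le> Suc k"
        by (auto simp: card_Diff_singleton_if split: if_splits)
    next
      assume "finite ?S \<and> card ?S \<le> Suc k"
      then show "\<exists>a\<in>univ N. finite (?S - {a}) \<and> card (?S - {a}) \<le> k"
        using b by (intro bexI[of _ b]) auto
    qed
  qed
  finally show ?case .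
qed

section \<open>The closure operators\<close>

lemma dcl_subset_acl: "dcl L N A \<subseteq> acl L N A"
  unfolding dcl_def acl_def by (fastforce intro: finite.intros)

lemma acl_subset_univ: "acl L N A \<subseteq> univ N"
  unfolding acl_def solutions_def by auto

lemma subset_dcl:
  assumes "A \<subseteq> univ N"
  shows "A \<subseteq> dcl L N A"
proof
  fix b assume "b \<in> A"
  then have "param_formula L A (FEq (TVar 0) (TVar 1)) (\<lambda>_. b)"
    "solutions N (FEq (TVar 0) (TVar 1)) (\<lambda>_. b) = {b}"
    using assms by (auto simp: param_formula_def solutions_def)
  then show "b \<in> dcl L N A" unfolding dcl_def by blast
qed

lemma subset_acl: "A \<subseteq> univ N \<Longrightarrow> A \<subseteq> acl L N A"
  using subset_dcl dcl_subset_acl by (rule subset_trans)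

text \<open>Shifting the variables of \<open>t\<close> by \<open>Suc\<close> frees variable 0 for
  the value to be defined.\<close>

lemma tm_val_in_dcl:
  assumes "term_of L t" "\<And>x. x \<in> tm_vars t \<Longrightarrow> e x \<in> A" "tm_val N e t \<in> univ N"
  shows "tm_val N e t \<in> dcl L N A"
proof -
  let ?\<phi> = "FEq (TVar 0) (rename_tm Suc t)" and ?e = "case_nat undefined e"
  have "(case_nat undefined e)(0 := b) \<circ> Suc = e" for b by auto
  then have "solutions N ?\<phi> ?e = {tm_val N e t}"
    using assms(3) by (auto simp: solutions_def tm_val_rename)
  moreover have "param_formula L A ?\<phi> ?e"
    using assms by (auto simp: param_formula_def term_of_rename tm_vars_rename)
  ultimately show ?thesis unfolding dcl_def by blast
qed

text \<open>
  A parameter \<open>c\<close> that is itself algebraic is quantified away. The conjunct \<^const>\<open>at_most\<close> keeps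
  only those values of \<open>c\<close> that leave the solution set finite.
\<close>

lemma acl_eliminate_parameters:
  assumes ne: "univ N \<noteq> {}"
    and "param_formula L (acl L N A) \<phi> e" "finite (solutions N \<phi> e)"
    and A: "A \<subseteq> univ N"
  shows "\<exists>\<phi>' e'. param_formula L A \<phi>' e' \<and> finite (solutions N \<phi>' e') \<and>
    solutions N \<phi> e \<subseteq> solutions N \<phi>' e'"
  using assms(2,3)
\<comment> \<open>The measure counts the parameter variables whose value lies outside
  \<open>A\<close>; each step binds one of them and adds only parameters from
  \<open>A\<close>.\<close>
proof (induction "card {x \<in> free_vars \<phi> - {0}. e x \<notin> A}" arbitrary: \<phi> e rule: less_induct)
  case less
  show ?case
  proof (cases "\<forall>x \<in> free_vars \<phi> - {0}. e x \<in> A")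
    case True
    then show ?thesis using less.prems unfolding param_formula_def by blast
  next
    case False
    then obtain v where v: "v \<in> free_vars \<phi>" "v \<noteq> 0" "e v \<notin> A" by blast
    have "e v \<in> acl L N A" using less.prems(1) v by (auto simp: param_formula_def)
    then obtain \<psi> d where \<psi>: "param_formula L A \<psi> d" "finite (solutions N \<psi> d)" "e v \<in> solutions N \<psi> d"
      unfolding acl_def by blast
    obtain n where n: "\<And>x. x \<in> insert 0 (free_vars \<phi>) \<Longrightarrow> x < n"
      using finite_nat_set_iff_bounded[of "insert 0 (free_vars \<phi>)"] finite_free_vars[of \<phi>] by auto
    \<comment> \<open>The solution variable of \<open>\<psi>\<close> becomes \<open>v\<close>, the
      variable to be bound; its parameter variables move to \<open>n\<close> and beyond, away from
      those of \<open>\<phi>\<close>.\<close>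
    define \<rho> where "\<rho> = case_nat v (\<lambda>i. n + i)"
    have \<rho>: "\<rho> 0 = v" "\<rho> (Suc i) = n + i" for i by (simp_all add: \<rho>_def)
    have "v < n" "0 < n" using n v by auto
    then have inj: "inj \<rho>" by (auto simp: inj_def \<rho>_def split: nat.splits)
    define e' where "e' x = (if x < n then e x else d (Suc (x - n)))" for x
    \<comment> \<open>With this bound the original value \<open>e v\<close> passes the counting
      conjunct, so no solution of \<open>\<phi>\<close> is lost.\<close>
    define k where "k = card (solutions N \<phi> e)"
    let ?\<phi> = "FEx v (FAnd (rename_fm \<rho> \<psi>) (FAnd \<phi> (at_most k \<phi>)))"
    have fv: "free_vars ?\<phi> - {0} \<subseteq> (free_vars \<phi> - {0, v}) \<union> (\<lambda>i. n + i) ` {i. Suc i \<in> free_vars \<psi>}"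
    proof -
      have "\<rho> ` free_vars \<psi> \<subseteq> insert v ((\<lambda>i. n + i) ` {i. Suc i \<in> free_vars \<psi>})"
        by (force simp: \<rho>_def split: nat.splits)
      then show ?thesis by (auto simp: free_vars_rename[OF inj] free_vars_at_most)
    qed
    have e': "e' x = e x" if "x \<in> free_vars \<phi>" for x using n that by (simp add: e'_def)
    have e'd: "e' (n + i) = d (Suc i)" for i by (simp add: e'_def)
    have dA: "d (Suc i) \<in> A" if "Suc i \<in> free_vars \<psi>" for i
      using \<psi>(1) that by (auto simp: param_formula_def)
    have sol: "solutions N ?\<phi> e' = {b \<in> univ N. \<exists>c\<in>solutions N \<psi> d. b \<in> solutions N \<phi> (e(v := c)) \<and>
        finite (solutions N \<phi> (e(v := c))) \<and> card (solutions N \<phi> (e(v := c))) \<le> k}"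
    proof -
      have 1: "sat N (e'(0 := b, v := c)) (rename_fm \<rho> \<psi>) \<longleftrightarrow> sat N (d(0 := c)) \<psi>" for b c
        unfolding sat_rename[OF inj]
      proof (rule sat_cong)
        show "(e'(0 := b, v := c) \<circ> \<rho>) x = (d(0 := c)) x" for x
          using \<open>v < n\<close> \<open>0 < n\<close> by (cases x) (auto simp: \<rho> e'd)
      qed
      have 2: "sat N (e'(0 := b, v := c)) \<phi> \<longleftrightarrow> sat N (e(v := c, 0 := b)) \<phi>" for b c
        using e' v(2) by (intro sat_cong) auto
      have 3: "solutions N \<phi> (e'(0 := b, v := c)) = solutions N \<phi> (e(v := c))" for b c
        using e' by (intro solutions_cong) auto
      show ?thesis
        by (auto simp: solutions_def[of N ?\<phi>] sat_at_most[OF ne] 1 2 3)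
          (auto simp: solutions_def)
    qed
    have "{x \<in> free_vars ?\<phi> - {0}. e' x \<notin> A} \<subset> {x \<in> free_vars \<phi> - {0}. e x \<notin> A}"
    proof -
      have "x \<in> {x \<in> free_vars \<phi> - {0}. e x \<notin> A} - {v}" if x: "x \<in> free_vars ?\<phi> - {0}" "e' x \<notin> A" for x
        using subsetD[OF fv x(1)] x(2) e' e'd dA by (elim UnE imageE) auto
      moreover have "v \<in> {x \<in> free_vars \<phi> - {0}. e x \<notin> A}" using v by simp
      ultimately show ?thesis by blast
    qed
    then have "card {x \<in> free_vars ?\<phi> - {0}. e' x \<notin> A} < card {x \<in> free_vars \<phi> - {0}. e x \<notin> A}"
      by (rule psubset_card_mono[rotated]) (auto simp: finite_free_vars)
    moreover have "param_formula L (acl L N A) ?\<phi> e'"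
    proof -
      have "d (Suc i) \<in> acl L N A" if "Suc i \<in> free_vars \<psi>" for i
        using dA[OF that] by (rule subsetD[OF subset_acl[OF A]])
      then have "e' x \<in> acl L N A" if "x \<in> free_vars ?\<phi> - {0}" for x
        using subsetD[OF fv that] e' e'd less.prems(1) unfolding param_formula_def
        by (elim UnE imageE) auto
      then show ?thesis
        using less.prems(1) \<psi>(1) unfolding param_formula_def
        by (simp add: formula_of_rename formula_of_at_most)
    qed
    moreover have "finite (solutions N ?\<phi> e')"
    proof -
      \<comment> \<open>A finite union of finite sets: \<open>\<psi>\<close> leaves finitely many
        \<open>c\<close>, and the counting conjunct discards those with infinitely many
        solutions.\<close>
      have "solutions N ?\<phi> e' \<subseteq> (\<Union>c\<in>{c \<in> solutions N \<psi> d. finite (solutions N \<phi> (e(v := c)))}.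
          solutions N \<phi> (e(v := c)))"
        unfolding sol by auto
      then show ?thesis by (rule finite_subset) (use \<psi>(2) in auto)
    qed
    ultimately obtain \<phi>' e'' where "param_formula L A \<phi>' e''" "finite (solutions N \<phi>' e'')"
      "solutions N ?\<phi> e' \<subseteq> solutions N \<phi>' e''"
      using less.hyps[of ?\<phi> e'] by blast
    moreover have "solutions N \<phi> e \<subseteq> solutions N ?\<phi> e'"
      unfolding sol using \<psi>(3) less.prems(2) by (auto simp: k_def intro!: bexI[of _ "e v"])
        (auto simp: solutions_def)
    ultimately show ?thesis by blast
  qed
qed

text \<open>With \<open>dcl_subset_acl\<close> this makes \<open>acl L N A\<close> definably
  closed.\<close>

lemma acl_acl:
  assumes "univ N \<noteq> {}" "A \<subseteq> univ N"
  shows "acl L N (acl L N A) \<subseteq> acl L N A"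
proof
  fix b assume "b \<in> acl L N (acl L N A)"
  then obtain \<phi> e where "param_formula L (acl L N A) \<phi> e" "finite (solutions N \<phi> e)"
    "b \<in> solutions N \<phi> e"
    unfolding acl_def by blast
  then show "b \<in> acl L N A"
    using acl_eliminate_parameters[OF assms(1) _ _ assms(2), of L \<phi> e] unfolding acl_def by blast
qed

section \<open>Elementarity of isomorphisms in algebraically closed fields\<close>

text \<open>In a finite field the product of all \<open>X - a\<close> vanishes everywhere, so adding
  1 gives a nonconstant polynomial without roots.\<close>

lemma infinite_UNIV_alg_closed: "infinite (UNIV :: 'a::alg_closed_field set)"
proof
  assume fin: "finite (UNIV :: 'a set)"
  define p :: "'a poly" where "p = (\<Prod>a\<in>UNIV. [:- a, 1:])"
  have p0: "poly p x = 0" for x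
    unfolding p_def poly_prod by (rule prod_zero[OF fin]) (auto intro: exI[of _ x])
  have "p \<noteq> 0" unfolding p_def using fin by auto
  have "degree (p + 1) > 0"
  proof (rule ccontr)
    assume "\<not> degree (p + 1) > 0"
    then obtain c where "p + 1 = [:c:]" by (auto elim: degree_eq_zeroE)
    then have "p = [:c:] - 1" by (metis add_diff_cancel)
    then have "p = [:c - 1:]" by (simp add: one_pCons)
    with p0[of 0] \<open>p \<noteq> 0\<close> show False by simp
  qed
  then obtain x where "poly (p + 1) x = 0" using alg_closed_imp_poly_has_root by blast
  with p0[of x] show False by simp
qed

lemma field_struct_simps [simp]: "univ field_struct = UNIV" "fint field_struct = field_fint"
  by (simp_all add: field_struct_def)

section \<open>Polynomial equations as formulas, and transcendental elements\<close>

primrec power_tm :: "nat \<Rightarrow> 'f tm" where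
  "power_tm 0 = TApp FOne []"
| "power_tm (Suc n) = TApp FTimes [TVar 0, power_tm n]"

primrec poly_tm :: "nat \<Rightarrow> 'f tm" where
  "poly_tm 0 = TApp FZero []"
| "poly_tm (Suc n) = TApp FPlus [poly_tm n, TApp FTimes [TVar (Suc n), power_tm n]]"

lemma tm_val_power_tm: "tm_val field_struct e (power_tm n) = e 0 ^ n"
  by (induction n) auto

lemma tm_val_poly_tm: "tm_val field_struct e (poly_tm n) = (\<Sum>i<n. e (Suc i) * e 0 ^ i)"
  by (induction n) (auto simp: tm_val_power_tm)

lemma term_of_poly_tm: "term_of field_lang (poly_tm n)"
proof -
  have "term_of field_lang (power_tm n)" for n by (induction n) (auto simp: field_lang_def)
  then show ?thesis by (induction n) (auto simp: field_lang_def)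
qed

text \<open>The type consisting of all \<open>q(x) \<noteq> 0\<close> is finitely satisfiable,
  because finitely many nonzero polynomials have finitely many roots in an infinite field.\<close>

lemma transcendental_exists:
  fixes F :: "'a::alg_closed_field set"
  assumes sat: "saturated field_lang \<kappa> (field_struct :: ('a, 'f, 'r) struct)"
    and F: "(card_of F, \<kappa>) \<in> ordLess"
  obtains c where "\<And>q. (\<And>i. coeff q i \<in> F) \<Longrightarrow> q \<noteq> 0 \<Longrightarrow> poly q c \<noteq> 0"
proof -
  define N where "N = (field_struct :: ('a, 'f, 'r) struct)"
  define fm :: "'a poly \<Rightarrow> ('f, 'r) fm" where
    "fm q = FNot (FEq (poly_tm (Suc (degree q))) (TApp FZero []))" for q
  \<comment> \<open>The shift matches \<open>poly_tm\<close>, which reads the coefficient of index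
    \<open>i\<close> from variable \<open>Suc i\<close>; the value at 0 is overwritten by the
    solution.\<close>
  define ev :: "'a poly \<Rightarrow> nat \<Rightarrow> 'a" where "ev q i = coeff q (i - 1)" for q i
  define Z where "Z = {q. (\<forall>i. coeff q i \<in> F) \<and> q \<noteq> 0}"
  define P where "P = (\<lambda>q. (fm q, ev q)) ` Z"
  have sol: "solutions N (fm q) (ev q) = {b. poly q b \<noteq> 0}" for q
  proof -
    have "tm_val N ((ev q)(0 := b)) (poly_tm (Suc (degree q))) = poly q b" for b
      unfolding N_def tm_val_poly_tm by (simp add: ev_def poly_altdef lessThan_Suc_atMost)
    then show ?thesis
      by (simp add: solutions_def fm_def N_def del: poly_tm.simps)
  qed
  have "\<forall>(\<phi>, e)\<in>P. param_formula field_lang F \<phi> e"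
    using term_of_poly_tm
    by (auto simp: P_def Z_def param_formula_def fm_def ev_def simp del: poly_tm.simps)
      (auto simp: field_lang_def)
  moreover have "\<exists>b\<in>univ N. \<forall>(\<phi>, e)\<in>Q. b \<in> solutions N \<phi> e" if Q: "Q \<subseteq> P" "finite Q" for Q
  proof -
    obtain Z' where Z': "Z' \<subseteq> Z" "finite Z'" "Q = (\<lambda>q. (fm q, ev q)) ` Z'"
      using finite_subset_image[OF Q(2), of "\<lambda>q. (fm q, ev q)" Z] Q(1) unfolding P_def by auto
    have "finite (\<Union>q\<in>Z'. {b. poly q b = 0})"
      using Z' by (intro finite_UN_I poly_roots_finite) (auto simp: Z_def)
    then obtain b where "b \<notin> (\<Union>q\<in>Z'. {b. poly q b = 0})"
      using ex_new_if_finite[OF infinite_UNIV_alg_closed] by blast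
    then show ?thesis using Z'(3) by (intro bexI[of _ b]) (auto simp: sol, simp add: N_def)
  qed
  moreover have "F \<subseteq> univ N" by (simp add: N_def)
  ultimately have "\<exists>b\<in>univ N. \<forall>(\<phi>, e)\<in>P. b \<in> solutions N \<phi> e"
    using sat F unfolding saturated_def N_def[symmetric] by blast
  then obtain c where "\<forall>q\<in>Z. poly q c \<noteq> 0" by (auto simp: P_def sol)
  then show ?thesis using that unfolding Z_def by blast
qed

text \<open>Algebraic closedness alone supplies \<open>d\<close>, so this extension step works over
  subfields of any size; \<open>extend_field_corr\<close> relies on that.\<close>

lemma algebraic_conjugate_exists:
  fixes c :: "'a::alg_closed_field"
  assumes G: "field_corr G" and p: "poly_pair G p q" "p \<noteq> 0" "poly p c = 0"
  obtains d where "conjugate G c d"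
proof -
  obtain m1 m2 where m: "min_pair G c m1 m2" using min_pair_exists[OF assms] .
  then have "degree m2 > 0"
    using min_pair_degree_pos poly_pair_degree[OF G min_pairD(1)[OF m]] by fastforce
  then obtain d where "poly m2 d = 0" using alg_closed_imp_poly_has_root by blast
  then show ?thesis using that min_pair_conjugate[OF G m] by blast
qed

text \<open>A transcendental \<open>c\<close> can be sent to any \<open>d\<close> transcendental
  over the range, so it is the range whose size must be controlled.\<close>

lemma conjugate_exists:
  fixes G :: "('a::alg_closed_field \<times> 'a) set"
  assumes sat: "saturated field_lang \<kappa> (field_struct :: ('a, 'f, 'r) struct)"
    and G: "field_corr G" and small: "(card_of (Range G), \<kappa>) \<in> ordLess"
  obtains d where "conjugate G c d"
proof (cases "\<exists>p q. poly_pair G p q \<and> p \<noteq> 0 \<and> poly p c = 0")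
  case True
  then show ?thesis using algebraic_conjugate_exists[OF G] that by blast
next
  case False
  obtain d where d: "\<And>q. (\<And>i. coeff q i \<in> Range G) \<Longrightarrow> q \<noteq> 0 \<Longrightarrow> poly q d \<noteq> 0"
    using transcendental_exists[OF sat small] by blast
  have "poly p c = 0 \<longleftrightarrow> poly q d = 0" if pq: "poly_pair G p q" for p q
  proof -
    have "q = 0" if "poly q d = 0"
      using d[of q] that pq unfolding poly_pair_def by (auto simp: Range_iff)
    moreover have "p = 0" if "poly p c = 0" using that pq False by blast
    ultimately show ?thesis using poly_pair_eq_0[OF G pq] by auto
  qed
  then show ?thesis using that unfolding conjugate_def by blast
qed

text \<open>The correspondence between the subfields generated by the values of \<open>e\<close> and
  of \<open>e'\<close>. It is no larger than the set of terms, however large the correspondence it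
  is cut out of.\<close>

definition term_corr ::
  "('a, 'f, 'r) struct \<Rightarrow> (nat \<Rightarrow> 'a) \<Rightarrow> (nat \<Rightarrow> 'a) \<Rightarrow> ('a \<times> 'a) set" where
  "term_corr N e e' =
     {(tm_val N e t, tm_val N e' t) | t. term_of (field_lang :: ('f, 'r) lang) t}"

lemma tm_val_field_corr:
  assumes G: "field_corr G" and e: "\<And>i. (e i, e' i) \<in> G"
    and t: "term_of (field_lang :: ('f, 'r) lang) t"
  shows "(tm_val (field_struct :: (_, 'f, 'r) struct) e t, tm_val (field_struct :: (_, 'f, 'r) struct) e' t) \<in> G"
  using t
proof (induction t)
  case (TVar x)
  then show ?case using e by simp
next
  case (TApp s ts)
  let ?N = "field_struct :: (_, 'f, 'r) struct"
  have IH: "(tm_val ?N e t, tm_val ?N e' t) \<in> G" if "t \<in> set ts" for t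
    using TApp that by simp
  have s: "s \<in> {FZero, FOne, FPlus, FNeg, FTimes, FInv}" and len: "length ts = arity s"
    using TApp.prems by (simp_all add: field_lang_def)
  note GD = field_corrD[OF G]
  from s consider (nullary) "s = FZero \<or> s = FOne" | (unary) "s = FNeg \<or> s = FInv"
    | (binary) "s = FPlus \<or> s = FTimes" by blast
  then show ?case
  proof cases
    case nullary
    then show ?thesis using GD(1,2) by auto
  next
    case unary
    then obtain t where "ts = [t]" using len by (auto simp: length_Suc_conv)
    then show ?thesis using unary IH[of t] GD(5,6) by auto
  next
    case binary
    then obtain t u where "ts = [t, u]" using len by (auto simp: length_Suc_conv numeral_2_eq_2)
    then show ?thesis using binary IH[of t] IH[of u] GD(3,4) by auto
  qed
qed

lemma field_corr_term_corr:
  assumes G: "field_corr G" and e: "\<And>i. (e i, e' i) \<in> G"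
  shows "field_corr (term_corr (field_struct :: ('a::field, 'f, 'r) struct) e e')"
    and "(e i, e' i) \<in> term_corr (field_struct :: ('a, 'f, 'r) struct) e e'"
proof -
  let ?N = "field_struct :: ('a, 'f, 'r) struct"
  let ?H = "term_corr ?N e e'"
  have I: "(x, y) \<in> ?H" if "term_of (field_lang :: ('f, 'r) lang) t"
    "x = tm_val ?N e t" "y = tm_val ?N e' t" for x y t
    using that unfolding term_corr_def by blast
  show "(e i, e' i) \<in> ?H" by (rule I[of "TVar i"]) auto
  have bin: "(x + x', y + y') \<in> ?H \<and> (x * x', y * y') \<in> ?H"
    if xy: "(x, y) \<in> ?H" "(x', y') \<in> ?H" for x y x' y'
  proof -
    obtain t t' where "term_of (field_lang :: ('f, 'r) lang) t" "term_of (field_lang :: ('f, 'r) lang) t'"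
      "x = tm_val ?N e t" "y = tm_val ?N e' t" "x' = tm_val ?N e t'" "y' = tm_val ?N e' t'"
      using xy unfolding term_corr_def by blast
    then show ?thesis
      using I[of "TApp FPlus [t, t']"] I[of "TApp FTimes [t, t']"]
      by (auto simp: field_lang_def)
  qed
  have un: "(- x, - y) \<in> ?H \<and> (inverse x, inverse y) \<in> ?H \<and> (x = 0 \<longleftrightarrow> y = 0)"
    if xy: "(x, y) \<in> ?H" for x y
  proof -
    obtain t where t: "term_of (field_lang :: ('f, 'r) lang) t" "x = tm_val ?N e t" "y = tm_val ?N e' t"
      using xy unfolding term_corr_def by blast
    \<comment> \<open>The other closure properties come from forming terms; this one is inherited
      from the ambient \<open>G\<close>.\<close>
    have "x = 0 \<longleftrightarrow> y = 0"
      using field_corr_zero[OF G tm_val_field_corr[OF G e t(1)]] t(2,3) by simp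
    then show ?thesis
      using t I[of "TApp FNeg [t]"] I[of "TApp FInv [t]"]
      by (auto simp: field_lang_def)
  qed
  have "(0, 0) \<in> ?H" "(1, 1) \<in> ?H"
    using I[of "TApp FZero []"] I[of "TApp FOne []"] by (auto simp: field_lang_def)
  then show "field_corr ?H" using bin un unfolding field_corr_def by blast
qed

text \<open>Terms inject into formulas by \<open>t \<mapsto> FEq t t\<close>, so the bound on
  formulas carries over.\<close>

lemma card_Range_term_corr:
  fixes L :: "('f, 'r) lang"
  assumes "sublang field_lang L" and "(card_of {\<phi>. formula_of L \<phi>}, \<kappa>) \<in> ordLess"
  shows "(card_of (Range (term_corr (N :: ('a, 'f, 'r) struct) e e')), \<kappa>) \<in> ordLess"
proof -
  have "term_of L t" if "term_of (field_lang :: ('f, 'r) lang) t" for t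
    using that assms(1) by (induction t) (auto simp: sublang_def)
  then have im: "(\<lambda>t. FEq t t) ` {t. term_of (field_lang :: ('f, 'r) lang) t} \<subseteq> {\<phi>. formula_of L \<phi>}"
    by auto
  have "inj_on (\<lambda>t. FEq t t) {t. term_of (field_lang :: ('f, 'r) lang) t}"
    by (rule inj_onI) simp
  then have "(card_of {t. term_of (field_lang :: ('f, 'r) lang) t}, card_of {\<phi>. formula_of L \<phi>}) \<in> ordLeq"
    using im by (intro iffD1[OF card_of_ordLeq] exI conjI)
  moreover have "Range (term_corr N e e') = tm_val N e' ` {t. term_of (field_lang :: ('f, 'r) lang) t}"
    by (auto simp: term_corr_def)
  then have "(card_of (Range (term_corr N e e')), card_of {t. term_of (field_lang :: ('f, 'r) lang) t}) \<in> ordLeq"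
    using card_of_image[of "tm_val N e'"] by simp
  ultimately show ?thesis
    using ordLeq_transitive ordLeq_ordLess_trans assms(2) by blast
qed

text \<open>Induction on the formula with \<open>G\<close> varying. At a quantifier \<open>G\<close>
  shrinks to the small \<open>H\<close>, which \<open>conjugate_exists\<close> can extend by the
  witness. The backward direction is the same step for the converse relation.\<close>

lemma sat_field_corr:
  fixes L :: "('f, 'r) lang" and G :: "('a::alg_closed_field \<times> 'a) set"
  assumes sat: "saturated field_lang \<kappa> (field_struct :: ('a, 'f, 'r) struct)"
    and L: "sublang field_lang L" "(card_of {\<phi>. formula_of L \<phi>}, \<kappa>) \<in> ordLess"
    and "formula_of field_lang \<phi>" "field_corr G" "\<And>i. (e i, e' i) \<in> G"
  shows "sat (field_struct :: ('a, 'f, 'r) struct) e \<phi> \<longleftrightarrow> sat (field_struct :: ('a, 'f, 'r) struct) e' \<phi>"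
  using assms(4-6)
proof (induction \<phi> arbitrary: G e e')
  case (FEq t u)
  then show ?case
    using tm_val_field_corr[OF FEq(2,3), of t] tm_val_field_corr[OF FEq(2,3), of u]
      field_corr_unique[OF FEq(2)] by fastforce
next
  case (FRel R ts)
  then show ?case by (simp add: field_lang_def)
next
  case (FNot \<phi>)
  have "sat (field_struct :: ('a, 'f, 'r) struct) e \<phi> \<longleftrightarrow> sat (field_struct :: ('a, 'f, 'r) struct) e' \<phi>"
    by (rule FNot.IH[of G]) (use FNot.prems in auto)
  then show ?case by simp
next
  case (FAnd \<phi> \<psi>)
  have "sat (field_struct :: ('a, 'f, 'r) struct) e \<phi> \<longleftrightarrow> sat (field_struct :: ('a, 'f, 'r) struct) e' \<phi>"
    by (rule FAnd.IH(1)[of G]) (use FAnd.prems in auto)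
  moreover have "sat (field_struct :: ('a, 'f, 'r) struct) e \<psi> \<longleftrightarrow> sat (field_struct :: ('a, 'f, 'r) struct) e' \<psi>"
    by (rule FAnd.IH(2)[of G]) (use FAnd.prems in auto)
  ultimately show ?case by simp
next
  case (FEx x \<phi>)
  let ?N = "field_struct :: ('a, 'f, 'r) struct"
  have step: "\<exists>d. sat ?N (e'(x := d)) \<phi>"
    if G: "field_corr G" and e: "\<And>i. (e i, e' i) \<in> G" and c: "sat ?N (e(x := c)) \<phi>" for G e e' c
  proof -
    define H where "H = term_corr ?N e e'"
    have H: "field_corr H" "\<And>i. (e i, e' i) \<in> H"
      unfolding H_def by (rule field_corr_term_corr[OF G e])+
    obtain d where d: "conjugate H c d"
      using conjugate_exists[OF sat H(1)] card_Range_term_corr[OF L] unfolding H_def by blast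
    have "((e(x := c)) i, (e'(x := d)) i) \<in> adjoin H c d" for i
      using subsetD[OF adjoin_superset(1)[OF H(1)] H(2)] adjoin_superset(2)[OF H(1)] by simp
    then have "sat ?N (e(x := c)) \<phi> \<longleftrightarrow> sat ?N (e'(x := d)) \<phi>"
      using FEx.prems(1) field_corr_adjoin[OF H(1) d] by (intro FEx.IH[of "adjoin H c d"]) simp_all
    then show ?thesis using c by blast
  qed
  have "\<exists>c. sat ?N (e(x := c)) \<phi>" if "sat ?N (e'(x := d)) \<phi>" for d
    using step[OF field_corr_converse[OF FEx.prems(2)], of e' e] FEx.prems(3) that by auto
  moreover have "\<exists>d. sat ?N (e'(x := d)) \<phi>" if "sat ?N (e(x := c)) \<phi>" for c
    using step[OF FEx.prems(2,3) that] .
  ultimately show ?case by auto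
qed

lemma solutions_conjugate:
  fixes L :: "('f, 'r) lang" and A :: "'a::alg_closed_field set"
  assumes sat: "saturated field_lang \<kappa> (field_struct :: ('a, 'f, 'r) struct)"
    and L: "sublang field_lang L" "(card_of {\<phi>. formula_of L \<phi>}, \<kappa>) \<in> ordLess"
    and A: "subfield_set A" and \<phi>: "param_formula field_lang A \<phi> e"
    and c: "c \<in> solutions (field_struct :: ('a, 'f, 'r) struct) \<phi> e"
    and conj: "conjugate (Id_on A) c d"
  shows "d \<in> solutions (field_struct :: ('a, 'f, 'r) struct) \<phi> e"
proof -
  let ?N = "field_struct :: ('a, 'f, 'r) struct"
  note G = field_corr_Id_on[OF A]
  \<comment> \<open>Irrelevant variables get the default 0, so that every value lies in
    \<open>A\<close>, as \<open>sat_field_corr\<close> demands of all indices.\<close>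
  define e' where "e' x = (if x \<in> free_vars \<phi> - {0} then e x else 0)" for x
  have sol: "solutions ?N \<phi> e' = solutions ?N \<phi> e"
    by (rule solutions_cong) (simp add: e'_def)
  have e': "e' x \<in> A" for x
    using \<phi> A by (auto simp: e'_def param_formula_def subfield_set_def)
  have "((e'(0 := c)) i, (e'(0 := d)) i) \<in> adjoin (Id_on A) c d" for i
    using subsetD[OF adjoin_superset(1)[OF G]] adjoin_superset(2)[OF G] e' by (auto simp: Id_on_iff)
  then have "sat ?N (e'(0 := c)) \<phi> \<longleftrightarrow> sat ?N (e'(0 := d)) \<phi>"
    using \<phi> by (intro sat_field_corr[OF sat L _ field_corr_adjoin[OF G conj]])
      (simp_all add: param_formula_def)
  moreover have "sat ?N (e'(0 := c)) \<phi>" using c sol unfolding solutions_def by blast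
  ultimately have "d \<in> solutions ?N \<phi> e'"
    by (simp only: solutions_def mem_Collect_eq field_struct_simps UNIV_I)
  then show ?thesis using sol by simp
qed

lemma acl_field_algebraic:
  fixes L :: "('f, 'r) lang" and A :: "'a::alg_closed_field set"
  assumes sat: "saturated field_lang \<kappa> (field_struct :: ('a, 'f, 'r) struct)"
    and L: "sublang field_lang L" "(card_of {\<phi>. formula_of L \<phi>}, \<kappa>) \<in> ordLess"
    and A: "subfield_set A" and b: "b \<in> acl field_lang (field_struct :: ('a, 'f, 'r) struct) A"
  obtains p where "\<And>i. poly.coeff p i \<in> A" "p \<noteq> 0" "poly p b = 0"
proof -
  let ?N = "field_struct :: ('a, 'f, 'r) struct"
  note G = field_corr_Id_on[OF A]
  have "\<exists>p. (\<forall>i. poly.coeff p i \<in> A) \<and> p \<noteq> 0 \<and> poly p b = 0"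
  proof (rule ccontr)
    assume "\<not> ?thesis"
    then have nz: "poly p b \<noteq> 0" if "poly_pair (Id_on A) p p" "p \<noteq> 0" for p
      using that by (auto simp: poly_pair_Id_on)
    have one: "(1, 1) \<in> Id_on A" using A by (auto simp: subfield_set_def)
    have mon: "poly_pair (Id_on A) (Polynomial.monom 1 n) (Polynomial.monom 1 n)" for n
      using poly_pair_monom[OF G one] .
    obtain \<phi> e where \<phi>: "param_formula field_lang A \<phi> e" "finite (solutions ?N \<phi> e)" "b \<in> solutions ?N \<phi> e"
      using b unfolding acl_def by blast
    \<comment> \<open>\<open>b\<close> is conjugate to its powers, because both are transcendental over \<open>A\<close>.\<close>
    have "b ^ Suc n \<in> solutions ?N \<phi> e" for n
    proof -
      have "poly p b = 0 \<longleftrightarrow> poly p (b ^ Suc n) = 0" if p: "poly_pair (Id_on A) p p" for p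
      proof (cases "p = 0")
        case False
        \<comment> \<open>Composing with this monomial turns an equation for the power into one for
          \<open>b\<close>. Its positive degree keeps the composite of a nonzero polynomial
          nonzero.\<close>
        let ?x = "Polynomial.monom (1 :: 'a) (Suc n)"
        have "poly_pair (Id_on A) (pcompose p ?x) (pcompose p ?x)"
          using p
        proof (induction p)
          case (pCons a p)
          then have "(a, a) \<in> Id_on A" "poly_pair (Id_on A) p p"
            unfolding poly_pair_def by (metis coeff_pCons_0, metis coeff_pCons_Suc)
          then show ?case
            unfolding pcompose_pCons using pCons.IH
            by (intro poly_pair_add[OF G] poly_pair_pCons[OF G] poly_pair_0[OF G] poly_pair_mult[OF G] mon)
        qed (simp add: poly_pair_0[OF G])
        moreover have "pcompose p ?x \<noteq> 0"
        proof
          assume "pcompose p ?x = 0"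
          then show False using False pcompose_eq_0[of p ?x] by (simp add: degree_monom_eq)
        qed
        ultimately have "poly (pcompose p ?x) b \<noteq> 0" using nz by blast
        then have "poly p (b ^ Suc n) \<noteq> 0" by (simp add: poly_pcompose poly_monom)
        then show ?thesis using nz[OF p False] by simp
      qed simp
      then have conj: "conjugate (Id_on A) b (b ^ Suc n)"
        by (auto simp: conjugate_def poly_pair_Id_on)
      show ?thesis by (rule solutions_conjugate[OF sat L A \<phi>(1,3) conj])
    qed
    then have "range (\<lambda>n. b ^ Suc n) \<subseteq> solutions ?N \<phi> e" by blast
    then have "finite (range (\<lambda>n. b ^ Suc n))" using \<phi>(2) finite_subset by metis
    then have "\<not> inj (\<lambda>n. b ^ Suc n)" using finite_imageD infinite_UNIV_nat by blast
    then obtain m n where mn: "b ^ Suc m = b ^ Suc n" "m \<noteq> n" unfolding inj_def by blast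
    \<comment> \<open>Two equal powers give an algebraic equation for \<open>b\<close> over the
      prime field, against transcendence.\<close>
    let ?p = "Polynomial.monom (1 :: 'a) (Suc m) - Polynomial.monom 1 (Suc n)"
    have "poly.coeff ?p (Suc m) = 1" using mn(2) by simp
    then have "?p \<noteq> 0" by (metis coeff_0 zero_neq_one)
    moreover have "poly_pair (Id_on A) ?p ?p" by (intro poly_pair_diff[OF G] mon)
    ultimately have "poly ?p b \<noteq> 0" using nz by blast
    then show False using mn(1) by (simp add: poly_monom)
  qed
  then show ?thesis using that by blast
qed

section \<open>Separability and linear disjointness\<close>

text \<open>A dictionary: separability and separable closedness are stated for rings with a carrier,
  while all computations take place in the ambient field type with the same operations.\<close>

locale concrete_field = field R for R :: "'a::field ring" (structure) +
  assumes mult_eq: "x \<in> carrier R \<Longrightarrow> y \<in> carrier R \<Longrightarrow> x \<otimes> y = x * y"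
    and add_eq: "x \<in> carrier R \<Longrightarrow> y \<in> carrier R \<Longrightarrow> x \<oplus> y = x + y"
    and zero_eq: "\<zero> = 0"
    and one_eq: "\<one> = 1"
begin

lemma uminus_eq: "x \<in> carrier R \<Longrightarrow> \<ominus> x = - x"
  using r_neg[of x] add_eq[of x "\<ominus> x"] by (simp add: zero_eq eq_neg_iff_add_eq_0 add.commute)

lemma inverse_eq: "x \<in> carrier R \<Longrightarrow> x \<noteq> 0 \<Longrightarrow> inv x = inverse x"
  using Units_r_inv[of x] Units_inv_closed[of x] mult_eq[of x "inv x"]
  by (simp add: field_Units zero_eq one_eq field_simps)

lemma subfield_set_carrier: "subfield_set (carrier R)"
proof -
  have "inverse x \<in> carrier R" if "x \<in> carrier R" for x
    using Units_inv_closed[of x] inverse_eq[of x] that zero_eq zero_closed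
    by (cases "x = 0") (auto simp: field_Units)
  moreover have "- x \<in> carrier R" if "x \<in> carrier R" for x
    using uminus_eq[OF that] a_inv_closed[OF that] by simp
  ultimately show ?thesis
    using zero_eq one_eq mult_eq add_eq zero_closed one_closed a_closed m_closed
    unfolding subfield_set_def by metis
qed

lemma subfield_if_subfield_set:
  assumes "subfield_set K" "K \<subseteq> carrier R"
  shows "subfield K R"
proof (rule subfieldI')
  have K: "x \<in> K \<Longrightarrow> x \<in> carrier R" for x using assms(2) by blast
  show "subring K R"
    using assms K by (intro subringI) (auto simp: subfield_set_def one_eq uminus_eq mult_eq add_eq)
  show "inv k \<in> K" if "k \<in> K - {\<zero>}" for k
    using that inverse_eq[of k] assms K by (auto simp: subfield_set_def zero_eq)
qed

lemma power_eq: "x \<in> carrier R \<Longrightarrow> x [^] (n::nat) = x ^ n"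
proof (induction n)
  case (Suc n)
  then show ?case using nat_pow_closed[of x n] by (simp add: mult_eq)
qed (simp add: one_eq)

lemma add_pow_eq: "x \<in> carrier R \<Longrightarrow> [n] \<cdot> x = of_nat n * x" for n :: nat
proof (induction n)
  case (Suc n)
  then show ?case using add.nat_pow_closed[of x n] by (simp add: add_eq algebra_simps)
qed (simp add: zero_eq)

lemma finsum_eq: "(\<And>i. i \<in> I \<Longrightarrow> f i \<in> carrier R) \<Longrightarrow> finite I \<Longrightarrow> finsum R f I = sum f I"
proof (induction I rule: infinite_finite_induct)
  case (insert i I)
  then have "finsum R f I \<in> carrier R" by (intro finsum_closed) auto
  then show ?case using insert by (simp add: Pi_def add_eq)
qed (simp_all add: zero_eq)

lemma combine_eq:
  "set Ks \<subseteq> carrier R \<Longrightarrow> set Us \<subseteq> carrier R \<Longrightarrow> combine Ks Us = (\<Sum>(k, u)\<leftarrow>zip Ks Us. k * u)"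
proof (induction Ks Us rule: combine.induct)
  case (1 k Ks u Us)
  then have "combine Ks Us \<in> carrier R" by (intro combine_in_carrier) auto
  moreover have "k \<otimes> u \<in> carrier R" using 1 by (intro m_closed) auto
  ultimately show ?case using 1 by (simp add: add_eq mult_eq)
qed (simp_all add: zero_eq)

end

text \<open>Frobenius is additive. The sets of \<open>p\<close>-th powers must be subfields before
  linear independence over them can be converted into relations.\<close>

lemma subfield_set_power_image:
  fixes K :: "'a::field set"
  assumes "prime p" "CHAR('a) = p" "subfield_set K"
  shows "subfield_set ((\<lambda>x. x ^ p) ` K)"
proof -
  have p: "p > 0" using assms(1) by (simp add: prime_gt_0_nat)
  let ?S = "(\<lambda>x. x ^ p) ` K"
  note K = assms(3)[unfolded subfield_set_def]
  have I: "z \<in> ?S" if "x \<in> K" "z = x ^ p" for x z using that by blast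
  show ?thesis
    unfolding subfield_set_def
  proof (intro conjI ballI)
    show "0 \<in> ?S" using K p by (intro I[of 0]) auto
    show "1 \<in> ?S" using K by (intro I[of 1]) auto
  next
    fix x y assume "x \<in> ?S" "y \<in> ?S"
    then obtain x' y' where xy: "x' \<in> K" "y' \<in> K" "x = x' ^ p" "y = y' ^ p" by blast
    show "x + y \<in> ?S" using K xy assms by (intro I[of "x' + y'"]) (auto simp: freshmans_dream)
    show "x * y \<in> ?S" using K xy by (intro I[of "x' * y'"]) (auto simp: power_mult_distrib)
  next
    fix x assume "x \<in> ?S"
    then obtain x' where x: "x' \<in> K" "x = x' ^ p" by blast
    show "- x \<in> ?S" using K x assms by (intro I[of "- x'"]) (auto simp: minus_power_prime_CHAR)
    show "inverse x \<in> ?S" using K x by (intro I[of "inverse x'"]) (auto simp: power_inverse)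
  qed
qed

text \<open>The contrapositive of linear disjointness: the \<open>a i\<close> are dependent over the
  \<open>p\<close>-th powers of the big field, hence over those of \<open>A\<close>.\<close>

lemma (in concrete_field) linear_relation_power:
  assumes p: "prime p" "CHAR('a) = p" and sep: "separable_extension p R A"
    and A: "subfield_set A" "A \<subseteq> carrier R" and I: "finite I"
    and a: "\<And>i. i \<in> I \<Longrightarrow> a i \<in> A" and u: "\<And>i. i \<in> I \<Longrightarrow> u i \<in> carrier R"
    and rel: "(\<Sum>i\<in>I. a i * u i ^ p) = 0" and nz: "\<exists>i\<in>I. u i \<noteq> 0"
  shows "\<exists>d. (\<forall>i\<in>I. d i \<in> A) \<and> (\<exists>i\<in>I. d i \<noteq> 0) \<and> (\<Sum>i\<in>I. a i * d i ^ p) = 0"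
proof -
  have p0: "p > 0" using p(1) by (simp add: prime_gt_0_nat)
  define Ap where "Ap = (\<lambda>x. x ^ p) ` A"
  define Rp where "Rp = (\<lambda>x. x ^ p) ` carrier R"
  have pow: "(\<lambda>x. x [^] p) ` A = Ap" "(\<lambda>x. x [^] p) ` carrier R = Rp"
    unfolding Ap_def Rp_def using A(2) power_eq by (auto intro!: image_cong)
  have disj: "set us \<subseteq> A \<Longrightarrow> independent Ap us \<Longrightarrow> independent Rp us" for us
    using sep p0 unfolding separable_extension_def linearly_disjoint_def pow by blast
  have Rp_sub: "Rp \<subseteq> carrier R"
    unfolding Rp_def using power_eq nat_pow_closed by (metis image_subsetI)
  have Ap_sub: "Ap \<subseteq> carrier R" using A(2) Rp_sub unfolding Ap_def Rp_def by blast
  have Rp: "subfield Rp R" and Ap: "subfield Ap R"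
    using subfield_if_subfield_set[OF subfield_set_power_image[OF p]] A(1) subfield_set_carrier
      Rp_sub Ap_sub unfolding Ap_def Rp_def by blast+
  obtain xs where xs: "set xs = I" "distinct xs" using finite_distinct_list[OF I] by blast
  have us: "set (map a xs) \<subseteq> A" "set (map a xs) \<subseteq> carrier R" using a xs A(2) by auto
  have sum: "(\<Sum>(k, v)\<leftarrow>zip (map f xs) (map a xs). k * v) = (\<Sum>i\<in>I. a i * f i)" for f :: "'b \<Rightarrow> 'a"
  proof -
    have "(\<Sum>(k, v)\<leftarrow>zip (map f xs) (map a xs). k * v) = (\<Sum>i\<leftarrow>xs. a i * f i)"
      by (induction xs) (auto simp: mult.commute)
    then show ?thesis using xs sum_list_distinct_conv_sum_set by metis
  qed
  have "dependent Ap (map a xs)"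
  proof
    assume "independent Ap (map a xs)"
    then have ind: "independent Rp (map a xs)" using disj us(1) by blast
    let ?Ks = "map (\<lambda>i. u i ^ p) xs"
    have Ks: "set ?Ks \<subseteq> Rp" using u xs by (auto simp: Rp_def)
    have "combine ?Ks (map a xs) = \<zero>"
      using combine_eq[of ?Ks "map a xs"] Ks Rp_sub us(2) rel unfolding sum zero_eq by simp
    then have "set (take (length (map a xs)) ?Ks) \<subseteq> {\<zero>}"
      using independent_imp_trivial_combine[OF Rp ind Ks] by blast
    then have "u i ^ p = 0" if "i \<in> I" for i using that xs zero_eq by auto
    then show False using nz by auto
  qed
  then obtain Ks where Ks: "length Ks = length (map a xs)" "combine Ks (map a xs) = \<zero>"
    "set Ks \<subseteq> Ap" "set Ks \<noteq> {\<zero>}"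
    using dependent_imp_non_trivial_combine[OF Ap us(2)] by metis
  \<comment> \<open>Coefficients are recovered per index, since \<open>xs\<close> is distinct while
    the values \<open>a i\<close> may repeat.\<close>
  define g where "g i = the (map_of (zip xs Ks) i)" for i
  have g: "map g xs = Ks"
    using Ks(1) xs(2) by (intro nth_equalityI) (auto simp: g_def map_of_zip_nth)
  have "\<forall>i\<in>I. \<exists>d\<in>A. g i = d ^ p" using Ks(3) g xs(1) unfolding Ap_def by fastforce
  then obtain d where d: "\<And>i. i \<in> I \<Longrightarrow> d i \<in> A" "\<And>i. i \<in> I \<Longrightarrow> g i = d i ^ p" by metis
  have "(\<Sum>i\<in>I. a i * d i ^ p) = (\<Sum>i\<in>I. a i * g i)" using d(2) by simp
  also have "\<dots> = combine Ks (map a xs)"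
    using combine_eq[of Ks "map a xs"] Ks(3) Ap_sub us(2) unfolding g[symmetric] sum by simp
  finally have "(\<Sum>i\<in>I. a i * d i ^ p) = 0" using Ks(2) zero_eq by simp
  moreover have "\<exists>i\<in>I. d i \<noteq> 0"
  proof (rule ccontr)
    assume "\<not> ?thesis"
    then have "g i = 0" if "i \<in> I" for i using d that p0 by simp
    then have "set Ks \<subseteq> {0}" using g xs(1) by auto
    moreover have "set Ks \<noteq> {}" using nz xs(1) g by auto
    ultimately show False using Ks(4) zero_eq by (simp add: subset_singleton_iff)
  qed
  ultimately show ?thesis using d(1) by blast
qed

text \<open>
  Gaussian elimination: a relation \<open>\<Sum> a\<^sub>i d\<^sub>i\<^sup>p = 0\<close> over \<open>A\<^sup>p\<close> expresses some \<open>a\<^sub>k\<close> through the others,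
  which shortens the given relation by one term.
\<close>

lemma (in concrete_field) linear_relation_root:
  assumes p: "prime p" "CHAR('a) = p" and sep: "separable_extension p R A"
    and A: "subfield_set A" "A \<subseteq> carrier R" and "finite I"
    and "\<And>i. i \<in> I \<Longrightarrow> a i \<in> A" and "\<And>i. i \<in> I \<Longrightarrow> u i \<in> carrier R"
    and "(\<Sum>i\<in>I. a i * u i ^ p) = 0" and "\<exists>i\<in>I. a i \<noteq> 0"
  shows "\<exists>c. (\<forall>i\<in>I. c i \<in> A) \<and> (\<exists>i\<in>I. c i \<noteq> 0) \<and> (\<Sum>i\<in>I. c i * u i) = 0"
  using assms(6-)
proof (induction "card I" arbitrary: I u)
  case 0
  then show ?case by auto
next
  case (Suc n)
  note AD = A(1)[unfolded subfield_set_def]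
  show ?case
  proof (cases "\<exists>i\<in>I. u i \<noteq> 0")
    case False
    \<comment> \<open>All \<open>u i\<close> vanish and \<open>I\<close> is nonempty, so any nonzero
      coefficients do.\<close>
    then show ?thesis using AD Suc.prems(5) by (intro exI[of _ "\<lambda>_. 1"]) auto
  next
    case True
    then obtain d k where d: "\<And>i. i \<in> I \<Longrightarrow> d i \<in> A" and k: "k \<in> I" "d k \<noteq> 0"
      and rel: "(\<Sum>i\<in>I. a i * d i ^ p) = 0"
      using linear_relation_power[OF p sep A Suc.prems(1-4)] by metis
    define r where "r i = d i / d k" for i
    have r: "r i \<in> A" if "i \<in> I" for i
      using AD d k that unfolding r_def divide_inverse by blast
    let ?J = "I - {k}"
    have ak: "a k = - (\<Sum>i\<in>?J. a i * r i ^ p)"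
    proof -
      have "a k * d k ^ p + (\<Sum>i\<in>?J. a i * d i ^ p) = 0"
        using rel sum.remove[OF Suc.prems(1) k(1), of "\<lambda>i. a i * d i ^ p"] by simp
      then have "a k = - (\<Sum>i\<in>?J. a i * d i ^ p) / d k ^ p"
        using k(2) by (simp add: field_simps eq_neg_iff_add_eq_0)
      also have "\<dots> = - (\<Sum>i\<in>?J. a i * r i ^ p)"
        by (simp add: r_def power_divide sum_divide_distrib)
      finally show ?thesis .
    qed
    \<comment> \<open>Substituting for \<open>a k\<close> combines each \<open>u i ^ p\<close> with
      \<open>(r i * u k) ^ p\<close>, and additivity of Frobenius merges the two into one
      \<open>p\<close>-th power.\<close>
    let ?w = "\<lambda>i. u i - r i * u k"
    \<comment> \<open>Expanding \<open>((x - y) + y) ^ p\<close> avoids the sign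
      \<open>(-1) ^ p\<close>.\<close>
    have diff_power: "(x - y) ^ p = x ^ p - y ^ p" for x y :: 'a
    proof -
      have "((x - y) + y) ^ p = (x - y) ^ p + y ^ p" by (rule freshmans_dream) (use p in auto)
      then show ?thesis by (simp only: diff_add_cancel add_diff_cancel_right')
    qed
    have "(\<Sum>i\<in>?J. a i * ?w i ^ p) = (\<Sum>i\<in>?J. a i * u i ^ p) - (\<Sum>i\<in>?J. a i * r i ^ p) * u k ^ p"
      by (simp add: diff_power power_mult_distrib algebra_simps sum_subtractf sum_distrib_left)
    also have "\<dots> = (\<Sum>i\<in>?J. a i * u i ^ p) + a k * u k ^ p" using ak by simp
    also have "\<dots> = 0"
      using Suc.prems(4) sum.remove[OF Suc.prems(1) k(1), of "\<lambda>i. a i * u i ^ p"]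
      by (simp add: add.commute)
    finally have rel': "(\<Sum>i\<in>?J. a i * ?w i ^ p) = 0" .
    have nz: "\<exists>i\<in>?J. a i \<noteq> 0"
    proof (rule ccontr)
      assume *: "\<not> ?thesis"
      then have "a k = 0" using ak by simp
      with * show False using Suc.prems(5) by blast
    qed
    have w: "?w i \<in> carrier R" if "i \<in> ?J" for i
    proof -
      have "u i + - (r i * u k) \<in> carrier R"
        using that r[of i] A(2) Suc.prems(3)[of i] Suc.prems(3)[OF k(1)] subfield_set_carrier
        unfolding subfield_set_def by blast
      then show ?thesis by simp
    qed
    have "n = card ?J" using Suc.hyps(2) Suc.prems(1) k(1) by simp
    then obtain c where c: "\<forall>i\<in>?J. c i \<in> A" "\<exists>i\<in>?J. c i \<noteq> 0" "(\<Sum>i\<in>?J. c i * ?w i) = 0"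
      using Suc.hyps(1)[of ?J ?w] Suc.prems(1,2) w rel' nz by auto
    \<comment> \<open>Undoing the substitution: the coefficient of \<open>u k\<close> collects what
      was subtracted from the other terms.\<close>
    define c' where "c' i = (if i = k then - (\<Sum>i\<in>?J. c i * r i) else c i)" for i
    have "(\<Sum>i\<in>J. c i * r i) \<in> A" if "J \<subseteq> ?J" for J
      using finite_subset[OF that finite_Diff[OF Suc.prems(1)]] that c(1) r AD
      by (induction J rule: finite_induct) auto
    then have "\<forall>i\<in>I. c' i \<in> A" using c(1) AD unfolding c'_def by auto
    moreover have "\<exists>i\<in>I. c' i \<noteq> 0" using c(2) unfolding c'_def by auto
    moreover have "(\<Sum>i\<in>I. c' i * u i) = 0"
    proof -
      have "(\<Sum>i\<in>I. c' i * u i) = c' k * u k + (\<Sum>i\<in>?J. c' i * u i)"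
        using sum.remove[OF Suc.prems(1) k(1)] .
      also have "(\<Sum>i\<in>?J. c' i * u i) = (\<Sum>i\<in>?J. c i * u i)" by (simp add: c'_def)
      also have "c' k * u k = - (\<Sum>i\<in>?J. c i * (r i * u k))"
        by (simp add: c'_def sum_distrib_left sum_distrib_right mult_ac)
      finally show ?thesis using c(3) by (simp add: algebra_simps sum_subtractf)
    qed
    ultimately show ?thesis by blast
  qed
qed

section \<open>Separability of minimal polynomials\<close>

lemma pderiv_eq_0_coeff:
  fixes m :: "'a::field poly"
  assumes "pderiv m = 0" "poly.coeff m i \<noteq> 0"
  shows "CHAR('a) dvd i"
proof (cases i)
  case (Suc j)
  have "of_nat (Suc j) * poly.coeff m (Suc j) = 0" using assms(1) coeff_pderiv[of m j] by simp
  then have "(of_nat i :: 'a) = 0" using assms(2) Suc by simp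
  then show ?thesis by (simp add: of_nat_eq_0_iff_char_dvd)
qed simp

lemma poly_in_subfield_set:
  assumes "subfield_set A" "\<And>i. poly.coeff p i \<in> A" "x \<in> A"
  shows "poly p x \<in> A"
  using poly_pair_poly[OF field_corr_Id_on[OF assms(1)], of x x p p] assms
  by (auto simp: poly_pair_Id_on Id_on_iff)

text \<open>
  If \<open>m\<close> were a polynomial in \<open>x\<^sup>p\<close>, then \<open>m(b) = 0\<close> would be a relation between the \<open>p\<close>-th powers
  of the \<open>b\<^sup>j\<close> with \<open>j \<le> degree m / p\<close>, and linear disjointness would turn it into one between
  the \<open>b\<^sup>j\<close> themselves.
\<close>

lemma (in concrete_field) pderiv_min_pair_nonzero:
  assumes sep: "separable_extension p R A" and p: "p = 0 \<or> prime p" "CHAR('a) = p"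
    and A: "subfield_set A" "A \<subseteq> carrier R" and b: "b \<in> carrier R"
    and m: "min_pair (Id_on A) b m m'"
  shows "pderiv m \<noteq> 0"
proof
  assume m0: "pderiv m = 0"
  note mD = min_pairD[OF m]
  have pos: "Polynomial.degree m > 0" using min_pair_degree_pos[OF m] .
  have coeffA: "poly.coeff m i \<in> A" for i using mD(1) poly_pair_Id_on by blast
  have dvd: "p dvd i" if "poly.coeff m i \<noteq> 0" for i using pderiv_eq_0_coeff[OF m0 that] p(2) by simp
  have "p dvd Polynomial.degree m" using dvd mD(2) by simp
  then obtain k where k: "Polynomial.degree m = p * k" by (elim dvdE)
  \<comment> \<open>In characteristic 0 the divisibility would force degree 0, so only the prime
    case survives.\<close>
  have prime: "prime p" using p(1) k pos by auto
  define a where "a j = poly.coeff m (p * j)" for j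
  have "0 = (\<Sum>i\<le>p * k. poly.coeff m i * b ^ i)" using mD(3) by (simp add: poly_altdef k)
  also have "\<dots> = (\<Sum>i\<in>(\<lambda>j. p * j) ` {..k}. poly.coeff m i * b ^ i)"
  proof (rule sum.mono_neutral_right)
    show "\<forall>i\<in>{..p * k} - (\<lambda>j. p * j) ` {..k}. poly.coeff m i * b ^ i = 0"
    proof
      fix i assume i: "i \<in> {..p * k} - (\<lambda>j. p * j) ` {..k}"
      have "poly.coeff m i = 0"
      proof (rule ccontr)
        assume "poly.coeff m i \<noteq> 0"
        then obtain j where "i = p * j" using dvd by (metis dvdE)
        with i prime show False by (auto simp: prime_gt_0_nat)
      qed
      then show "poly.coeff m i * b ^ i = 0" by simp
    qed
  qed auto
  also have "\<dots> = (\<Sum>j\<le>k. a j * (b ^ j) ^ p)"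
    using prime by (subst sum.reindex)
      (auto simp: inj_on_def a_def prime_gt_0_nat simp flip: power_mult simp: mult.commute)
  finally have rel: "(\<Sum>j\<le>k. a j * (b ^ j) ^ p) = 0" by simp
  have "a k = 1" using mD(2) by (simp add: a_def k[symmetric])
  then have nz: "\<exists>j\<in>{..k}. a j \<noteq> 0" by (intro bexI[of _ k]) auto
  have "b ^ j \<in> carrier R" for j using power_eq[OF b] nat_pow_closed[OF b] by metis
  then obtain c where c: "\<forall>j\<in>{..k}. c j \<in> A" "\<exists>j\<in>{..k}. c j \<noteq> 0" "(\<Sum>j\<le>k. c j * b ^ j) = 0"
    using linear_relation_root[OF prime p(2) sep A finite_atMost _ _ rel nz] coeffA
    by (auto simp: a_def)
  define q where "q = (\<Sum>j\<le>k. Polynomial.monom (c j) j)"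
  have coeff_q: "poly.coeff q i = (if i \<le> k then c i else 0)" for i
    by (simp add: q_def coeff_sum)
  have "q \<noteq> 0" using c(2) coeff_q by (metis atMost_iff coeff_0)
  moreover have "poly_pair (Id_on A) q q"
    using c(1) A(1) by (auto simp: poly_pair_Id_on coeff_q subfield_set_def)
  moreover have "poly q b = 0" using c(3) by (simp add: q_def poly_sum poly_monom)
  ultimately have "Polynomial.degree m \<le> Polynomial.degree q" using mD(5) by blast
  moreover have "Polynomial.degree q \<le> k" by (rule degree_le) (simp add: coeff_q)
  moreover have "k < p * k" using pos k prime_gt_1_nat[OF prime] by simp
  ultimately show False using k by simp
qed

text \<open>A common root of \<open>m\<close> and its derivative is conjugate to \<open>b\<close>,
  so the derivative would kill \<open>b\<close> too, with smaller degree than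
  \<open>m\<close>.\<close>

lemma min_pair_separable:
  fixes m :: "'a::field poly"
  assumes A: "subfield_set A" and m: "min_pair (Id_on A) b m m'" and d: "pderiv m \<noteq> 0"
    and r: "poly m r = 0"
  shows "poly (pderiv m) r \<noteq> 0"
proof
  note G = field_corr_Id_on[OF A]
  note mD = min_pairD[OF m]
  assume *: "poly (pderiv m) r = 0"
  have "m' = m" using mD(1) by (simp add: poly_pair_Id_on)
  then have "conjugate (Id_on A) b r" using min_pair_conjugate[OF G m] r by simp
  moreover have pd: "poly_pair (Id_on A) (pderiv m) (pderiv m)"
    using poly_pair_pderiv[OF G mD(1)] \<open>m' = m\<close> by simp
  ultimately have "poly (pderiv m) b = 0" using * unfolding conjugate_def by blast
  then have "Polynomial.degree m \<le> Polynomial.degree (pderiv m)" using mD(5)[OF pd] d by simp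
  moreover have "Polynomial.degree (pderiv m) < Polynomial.degree m"
  proof -
    have "Polynomial.degree (pderiv m) \<le> Polynomial.degree m - 1"
      by (rule degree_le) (auto simp: coeff_pderiv coeff_eq_0)
    then show ?thesis using min_pair_degree_pos[OF m] by linarith
  qed
  ultimately show False by simp
qed

section \<open>Separably closed fields\<close>

context concrete_field
begin

text \<open>The two representations list coefficients in opposite orders, whence \<open>rev\<close>
  in all translations.\<close>

lemma coeff_eq: "coeff q i = poly.coeff (Poly (rev q)) i"
proof (cases "i < length q")
  case True
  then show ?thesis using coeff_nth[of i q] by (simp add: nth_default_nth rev_nth)
next
  case False
  then show ?thesis using coeff_length[of q i] by (simp add: nth_default_beyond zero_eq)
qed

lemma eval_eq:
  "set q \<subseteq> carrier R \<Longrightarrow> x \<in> carrier R \<Longrightarrow> eval q x = poly (Poly (rev q)) x"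
proof (induction q)
  case (Cons a q)
  have "poly (Poly (rev (a # q))) x = poly (Poly (rev q)) x + x ^ length q * a"
    by (simp add: Poly_append poly_monom)
  moreover have "eval (a # q) x = a \<otimes> (x [^] length q) \<oplus> eval q x" by simp
  moreover have "\<dots> = a * x ^ length q + eval q x"
  proof -
    have 1: "x [^] length q \<in> carrier R" "a \<in> carrier R" "eval q x \<in> carrier R"
      using Cons.prems by (auto intro: eval_in_carrier)
    then have "a \<otimes> (x [^] length q) \<in> carrier R" by simp
    then show ?thesis using 1 by (simp only: add_eq mult_eq power_eq[OF Cons.prems(2)])
  qed
  ultimately show ?case using Cons by (simp add: algebra_simps)
qed (simp add: zero_eq)

lemma Poly_poly_mult:
  assumes "set p \<subseteq> carrier R" "set q \<subseteq> carrier R"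
  shows "Poly (rev (poly_mult p q)) = Poly (rev p) * Poly (rev q)"
proof (rule poly_eqI)
  fix i
  have closed: "coeff p k \<in> carrier R" "coeff q k \<in> carrier R" for k
    using assms by (auto intro: coeff_in_carrier)
  have "coeff (poly_mult p q) i = (\<Oplus>k\<in>{..i}. coeff p k \<otimes> coeff q (i - k))"
    using poly_mult_coeff[OF assms] by simp
  also have "\<dots> = (\<Sum>k\<le>i. coeff p k \<otimes> coeff q (i - k))" using closed by (intro finsum_eq) auto
  also have "\<dots> = (\<Sum>k\<le>i. coeff p k * coeff q (i - k))" using closed by (simp add: mult_eq)
  finally show "poly.coeff (Poly (rev (poly_mult p q))) i = poly.coeff (Poly (rev p) * Poly (rev q)) i"
    unfolding coeff_eq coeff_mult .
qed

lemma Poly_formal_deriv: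
  assumes "set q \<subseteq> carrier R"
  shows "Poly (rev (formal_deriv R q)) = pderiv (Poly (rev q))"
proof (rule poly_eqI)
  fix i
  let ?l = "map (\<lambda>i. [i] \<cdot> coeff q i) (rev [1..<length q])"
  have "poly.coeff (Poly (rev (formal_deriv R q))) i = coeff ?l i"
    unfolding formal_deriv_def coeff_eq[symmetric] using normalize_coeff by metis
  also have "\<dots> = of_nat (Suc i) * coeff q (Suc i)"
  proof (cases "Suc i < length q")
    case True
    \<comment> \<open>\<open>?l\<close> has one entry fewer than \<open>q\<close>, so its
      coefficient of degree \<open>i\<close> sits at this position.\<close>
    then have "rev [1..<length q] ! (length q - Suc (Suc i)) = Suc i" by (subst rev_nth) auto
    then have "coeff ?l i = [Suc i] \<cdot> coeff q (Suc i)"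
      using coeff_nth[of i ?l] True by simp
    then show ?thesis using add_pow_eq[OF coeff_in_carrier[OF assms]] by (simp only:)
  next
    case False
    then show ?thesis using coeff_length[of ?l i] coeff_length[of q "Suc i"] by (simp add: zero_eq)
  qed
  finally show "poly.coeff (Poly (rev (formal_deriv R q))) i = poly.coeff (pderiv (Poly (rev q))) i"
    by (simp add: coeff_pderiv coeff_eq)
qed

end

text \<open>A common divisor over \<open>R\<close> remains one over the algebraically closed field;
  having no root there, it is constant.\<close>

lemma separable_polyI:
  fixes R :: "'a::alg_closed_field ring" and n :: "'a poly"
  assumes "concrete_field R"
    and n: "\<And>i. poly.coeff n i \<in> carrier R" "n \<noteq> 0"
    and sep: "\<And>s. poly n s = 0 \<Longrightarrow> poly (pderiv n) s \<noteq> 0"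
  shows "separable_poly R (rev (coeffs n))"
  unfolding separable_poly_def
proof (intro ballI impI)
  interpret concrete_field R by fact
  let ?q = "rev (coeffs n)"
  have q: "set ?q \<subseteq> carrier R" using n(1) by (auto simp: coeffs_def)
  fix d assume d: "d \<in> carrier (poly_ring R)"
    and dvd: "d divides\<^bsub>poly_ring R\<^esub> ?q \<and> d divides\<^bsub>poly_ring R\<^esub> formal_deriv R ?q"
  have set_carrier: "set c \<subseteq> carrier R" if "c \<in> carrier (poly_ring R)" for c
    using that by (auto simp: univ_poly_def polynomial_def)
  have dvd': "Poly (rev d) dvd Poly (rev r)" if "d divides\<^bsub>poly_ring R\<^esub> r" for r
  proof -
    obtain c where "c \<in> carrier (poly_ring R)" "r = poly_mult d c"
      using \<open>d divides\<^bsub>poly_ring R\<^esub> r\<close> unfolding factor_def univ_poly_mult by blast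
    then show ?thesis using Poly_poly_mult set_carrier d by simp
  qed
  have "Poly (rev d) dvd n" "Poly (rev d) dvd pderiv n"
    using dvd'[of ?q] dvd'[of "formal_deriv R ?q"] dvd Poly_formal_deriv[OF q] by simp_all
  then have "poly (Poly (rev d)) s \<noteq> 0" for s using sep[of s] by (metis dvd_def mult_zero_left poly_mult)
  then have deg: "Polynomial.degree (Poly (rev d)) = 0"
    using alg_closed_imp_poly_has_root by (metis gr0I)
  have "Poly (rev d) \<noteq> 0" using \<open>Poly (rev d) dvd n\<close> n(2) by auto
  then have "d \<noteq> []" by auto
  then have "hd d \<noteq> 0" using d by (auto simp: univ_poly_def polynomial_def zero_eq)
  have "length d = 1"
  proof -
    have "poly.coeff (Poly (rev d)) (length d - 1) = hd d"
      using \<open>d \<noteq> []\<close> by (simp add: nth_default_nth rev_nth hd_conv_nth)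
    then have "length d - 1 \<le> 0" using le_degree[of "Poly (rev d)"] deg \<open>hd d \<noteq> 0\<close> by metis
    with \<open>d \<noteq> []\<close> show ?thesis by (cases d) auto
  qed
  then show "d \<in> Units (poly_ring R)"
    using univ_poly_units'[OF carrier_is_subfield] d \<open>d \<noteq> []\<close> by simp
qed

text \<open>Separable closedness gives some root, but \<open>r\<close> is prescribed. So it is
  applied to the minimal polynomial \<open>n\<close> of \<open>r\<close> over \<open>R\<close>,
  which divides \<open>m\<close> and has only simple roots. A root \<open>s\<close> in
  \<open>R\<close> splits off \<open>X - s\<close> over \<open>R\<close>; by minimality the cofactor
  does not kill \<open>r\<close>, so \<open>r = s\<close>.\<close>

lemma root_in_separably_closed:
  fixes R :: "'a::alg_closed_field ring" and m :: "'a poly"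
  assumes R: "concrete_field R" "separably_closed R"
    and m: "\<And>i. poly.coeff m i \<in> carrier R" "m \<noteq> 0"
    and sep: "\<And>s. poly m s = 0 \<Longrightarrow> poly (pderiv m) s \<noteq> 0"
    and r: "poly m r = 0"
  shows "r \<in> carrier R"
proof -
  interpret concrete_field R by fact
  let ?G = "Id_on (carrier R)"
  note S = subfield_set_carrier
  note G = field_corr_Id_on[OF S]
  have pm: "poly_pair ?G m m" using m(1) by (simp add: poly_pair_Id_on)
  obtain n n' where n': "min_pair ?G r n n'" using min_pair_exists[OF G pm m(2) r] .
  note nD = min_pairD[OF n']
  have coeff_n: "poly.coeff n i \<in> carrier R" for i using nD(1) poly_pair_Id_on by blast
  obtain q where q: "m = n * q" using min_pair_dvd[OF G n' pm r] by metis
  have n_sep: "poly (pderiv n) s \<noteq> 0" if "poly n s = 0" for s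
    using sep[of s] that by (auto simp: q pderiv_mult)
  let ?q = "rev (coeffs n)"
  have set_q: "set ?q \<subseteq> carrier R" using coeff_n by (auto simp: coeffs_def)
  have "?q \<in> carrier (poly_ring R)"
    using set_q nD(2,4) by (auto simp: univ_poly_def polynomial_def hd_rev last_coeffs_eq_coeff_degree zero_eq)
  moreover have "length ?q - 1 > 0"
    using min_pair_degree_pos[OF n'] nD(4) by (simp add: length_coeffs)
  ultimately obtain s where s: "s \<in> carrier R" "eval ?q s = \<zero>\<^bsub>R\<^esub>"
    using R(2) separable_polyI[OF R(1) coeff_n nD(4) n_sep] unfolding separably_closed_def by blast
  have ns: "poly n s = 0" using eval_eq[OF set_q s(1)] s(2) zero_eq by simp
  let ?x = "[:- s, 1:]"
  have x: "poly_pair ?G ?x ?x" using s(1) S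
    by (auto simp: poly_pair_Id_on coeff_pCons subfield_set_def split: nat.split)
  have "poly_pair ?G n n" using coeff_n by (simp add: poly_pair_Id_on)
  then obtain q1 q2 r1 r2 where qr: "poly_pair ?G q1 q2" "n = ?x * q1 + r1"
    "r1 = 0 \<or> Polynomial.degree r1 < Polynomial.degree ?x"
    using poly_pair_division[OF G x] by (metis lead_coeff_pCons(1) lead_coeff_1 one_pCons one_neq_zero)
  have "r1 = 0"
  proof (rule ccontr)
    assume "r1 \<noteq> 0"
    then obtain c where c: "r1 = [:c:]" using qr(3) by (auto elim: degree_eq_zeroE)
    then have "c = 0" using ns qr(2) by simp
    with c \<open>r1 \<noteq> 0\<close> show False by simp
  qed
  then have n_eq: "n = ?x * q1" using qr(2) by simp
  then have "q1 \<noteq> 0" using nD(4) by auto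
  then have "Polynomial.degree q1 < Polynomial.degree n"
    using n_eq degree_mult_eq[of ?x q1] by (simp del: mult_pCons_left)
  then have "poly q1 r \<noteq> 0" using nD(5)[OF qr(1)] \<open>q1 \<noteq> 0\<close> by fastforce
  then have "poly ?x r = 0" using nD(3) n_eq by (metis mult_eq_0_iff poly_mult)
  then show ?thesis using s(1) by simp
qed

section \<open>Automorphisms of the relative algebraic closure\<close>

text \<open>Zorn's lemma. Only the domain is confined to \<open>B\<close>; the values may leave it,
  and normality of \<open>B\<close> brings them back later.\<close>

lemma extend_field_corr:
  fixes A B :: "'a::alg_closed_field set"
  assumes B: "subfield_set B"
    and alg: "\<And>x. x \<in> B \<Longrightarrow> \<exists>p. (\<forall>i. poly.coeff p i \<in> A) \<and> p \<noteq> 0 \<and> poly p x = 0"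
    and G0: "field_corr G0" "Id_on A \<subseteq> G0" "Domain G0 \<subseteq> B"
  obtains G where "field_corr G" "G0 \<subseteq> G" "Domain G = B"
proof -
  define Z where "Z = {G. field_corr G \<and> G0 \<subseteq> G \<and> Domain G \<subseteq> B}"
  have "\<exists>G\<in>Z. \<forall>H\<in>Z. G \<subseteq> H \<longrightarrow> H = G"
  proof (rule subset_Zorn_nonempty)
    show "Z \<noteq> {}" using G0 unfolding Z_def by blast
  next
    fix C assume C: "C \<noteq> {}" "subset.chain Z C"
    then have CZ: "C \<subseteq> Z" by (simp add: subset.chain_def)
    have corr: "field_corr H" if "H \<in> C" for H using that CZ unfolding Z_def by blast
    have common: "\<exists>H\<in>C. u \<in> H \<and> v \<in> H" if uv: "u \<in> \<Union>C" "v \<in> \<Union>C" for u v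
    proof -
      obtain H H' where H: "H \<in> C" "u \<in> H" "H' \<in> C" "v \<in> H'" using uv by blast
      then have "H \<subseteq> H' \<or> H' \<subseteq> H" using C(2) by (auto simp: subset_chain_def)
      then show ?thesis using H by blast
    qed
    have "(x + x', y + y') \<in> \<Union>C \<and> (x * x', y * y') \<in> \<Union>C"
      if xy: "(x, y) \<in> \<Union>C" "(x', y') \<in> \<Union>C" for x y x' y'
    proof -
      obtain H where H: "H \<in> C" "(x, y) \<in> H" "(x', y') \<in> H" using common[OF xy] by blast
      then have "(x + x', y + y') \<in> H" "(x * x', y * y') \<in> H"
        using field_corr_add[OF corr[OF H(1)]] field_corr_mult[OF corr[OF H(1)]] by simp_all
      then show ?thesis using H(1) by blast
    qed
    moreover have "(- x, - y) \<in> \<Union>C \<and> (inverse x, inverse y) \<in> \<Union>C \<and> (x = 0 \<longleftrightarrow> y = 0)"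
      if xy: "(x, y) \<in> \<Union>C" for x y
    proof -
      obtain H where H: "H \<in> C" "(x, y) \<in> H" using xy by blast
      note HD = field_corrD[OF corr[OF H(1)]]
      show ?thesis using HD(5)[OF H(2)] HD(6)[OF H(2)] HD(7)[OF H(2)] H(1) by blast
    qed
    moreover have "(0, 0) \<in> \<Union>C" "(1, 1) \<in> \<Union>C"
    proof -
      obtain H where "H \<in> C" using C(1) by blast
      then show "(0, 0) \<in> \<Union>C" "(1, 1) \<in> \<Union>C"
        using field_corr_0[OF corr] field_corr_1[OF corr] by blast+
    qed
    ultimately have "field_corr (\<Union>C)" by (intro field_corrI)
    moreover have "G0 \<subseteq> \<Union>C" using C(1) CZ unfolding Z_def by blast
    moreover have "Domain (\<Union>C) \<subseteq> B" using CZ unfolding Z_def by blast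
    ultimately show "\<Union>C \<in> Z" unfolding Z_def by blast
  qed
  then obtain G where GZ: "G \<in> Z" and max: "\<And>H. H \<in> Z \<Longrightarrow> G \<subseteq> H \<Longrightarrow> H = G" by metis
  then have G: "field_corr G" "G0 \<subseteq> G" "Domain G \<subseteq> B" by (simp_all add: Z_def)
  have "c \<in> Domain G" if c: "c \<in> B" for c
  proof -
    obtain p where p: "\<And>i. poly.coeff p i \<in> A" "p \<noteq> 0" "poly p c = 0" using alg[OF c] by blast
    have "poly_pair (Id_on A) p p" using p(1) by (simp add: poly_pair_Id_on)
    then have "poly_pair G p p" using G0(2) G(2) poly_pair_mono by blast
    then obtain d where d: "conjugate G c d" using algebraic_conjugate_exists[OF G(1) _ p(2,3)] by blast
    have "Domain (adjoin G c d) \<subseteq> B"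
    proof
      fix x assume "x \<in> Domain (adjoin G c d)"
      then obtain p1 p2 q1 q2 where pq: "poly_pair G p1 p2" "poly_pair G q1 q2"
        "x = poly p1 c / poly q1 c" unfolding adjoin_def by blast
      have "poly.coeff p1 i \<in> B" "poly.coeff q1 i \<in> B" for i
        using pq(1,2) G(3) unfolding poly_pair_def by blast+
      then have "poly p1 c \<in> B" "poly q1 c \<in> B" using poly_in_subfield_set[OF B _ c] by blast+
      then show "x \<in> B" using B pq(3) by (simp add: divide_inverse subfield_set_def)
    qed
    then have "adjoin G c d \<in> Z"
      using field_corr_adjoin[OF G(1) d] adjoin_superset(1)[OF G(1), of c d] G(2) by (auto simp: Z_def)
    then have "adjoin G c d = G" using max adjoin_superset(1)[OF G(1)] by simp
    then show ?thesis using adjoin_superset(2)[OF G(1), of c d] by blast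
  qed
  then have "Domain G = B" using G(3) by blast
  then show ?thesis using that G by blast
qed

lemma normal_automorphism_exists:
  fixes A B :: "'a::alg_closed_field set"
  assumes A: "subfield_set A" and B: "subfield_set B" and AB: "A \<subseteq> B"
    and alg: "\<And>x. x \<in> B \<Longrightarrow> \<exists>p. (\<forall>i. poly.coeff p i \<in> A) \<and> p \<noteq> 0 \<and> poly p x = 0"
    and normal: "\<And>x y. x \<in> B \<Longrightarrow> conjugate (Id_on A) x y \<Longrightarrow> y \<in> B"
    and b: "b \<in> B" "conjugate (Id_on A) b b'"
  obtains f where "bij_betw f B B" "\<And>x y. x \<in> B \<Longrightarrow> y \<in> B \<Longrightarrow> f (x + y) = f x + f y"
    "\<And>x y. x \<in> B \<Longrightarrow> y \<in> B \<Longrightarrow> f (x * y) = f x * f y" "\<And>a. a \<in> A \<Longrightarrow> f a = a" "f b = b'"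
proof -
  note GA = field_corr_Id_on[OF A]
  let ?G0 = "adjoin (Id_on A) b b'"
  have G0: "field_corr ?G0" "Id_on A \<subseteq> ?G0" "(b, b') \<in> ?G0"
    using field_corr_adjoin[OF GA b(2)] adjoin_superset[OF GA] by blast+
  have "Domain ?G0 \<subseteq> B"
  proof
    fix x assume "x \<in> Domain ?G0"
    then obtain p1 p2 q1 q2 where pq: "poly_pair (Id_on A) p1 p2" "poly_pair (Id_on A) q1 q2"
      "x = poly p1 b / poly q1 b" unfolding adjoin_def by blast
    have "poly.coeff p1 i \<in> B" "poly.coeff q1 i \<in> B" for i
      using pq(1,2) AB unfolding poly_pair_Id_on by blast+
    then have "poly p1 b \<in> B" "poly q1 b \<in> B" using poly_in_subfield_set[OF B _ b(1)] by blast+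
    then show "x \<in> B" using B pq(3) by (simp add: divide_inverse subfield_set_def)
  qed
  then obtain G where G: "field_corr G" "?G0 \<subseteq> G" "Domain G = B"
    using extend_field_corr[OF B alg G0(1,2)] by blast
  define f where "f x = (SOME y. (x, y) \<in> G)" for x
  have f: "(x, f x) \<in> G" if "x \<in> B" for x
    unfolding f_def by (rule someI_ex) (use that G(3) in blast)
  have f_eq: "f x = y" if "(x, y) \<in> G" for x y
  proof -
    have "x \<in> B" using that G(3) by blast
    from field_corr_unique[OF G(1) f[OF this] that] show ?thesis by simp
  qed
  \<comment> \<open>\<open>G\<close> fixes \<open>A\<close>, so polynomials over \<open>A\<close>
    correspond to themselves; hence \<open>f x\<close> is conjugate to \<open>x\<close> over
    \<open>A\<close>.\<close>
  have fix_poly: "poly p x = 0 \<longleftrightarrow> poly p (f x) = 0"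
    if "x \<in> B" "poly_pair (Id_on A) p p" for p x
    using field_corr_zero[OF G(1) poly_pair_poly[OF G(1) f]] that poly_pair_mono[OF _ that(2)]
      G0(2) G(2) by blast
  have conj: "conjugate (Id_on A) x (f x)" if "x \<in> B" for x
    using fix_poly[OF that] unfolding conjugate_def poly_pair_Id_on by blast
  have inj: "inj_on f B"
    using field_corr_unique[OF G(1) f f] by (intro inj_onI) blast
  have fB: "f ` B \<subseteq> B" using normal conj by blast
  have "B \<subseteq> f ` B"
  proof
    fix y assume y: "y \<in> B"
    obtain p where p: "\<And>i. poly.coeff p i \<in> A" "p \<noteq> 0" "poly p y = 0" using alg[OF y] by blast
    have pp: "poly_pair (Id_on A) p p" using p(1) by (simp add: poly_pair_Id_on)
    \<comment> \<open>Surjectivity is local: \<open>f\<close> maps the finite set of roots of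
      \<open>p\<close> in \<open>B\<close> injectively into itself.\<close>
    define S where "S = {z \<in> B. poly p z = 0}"
    have "finite S" unfolding S_def using poly_roots_finite[OF p(2)] by simp
    moreover have "f ` S \<subseteq> S" using fix_poly[OF _ pp] fB unfolding S_def by blast
    moreover have "inj_on f S" using inj unfolding S_def by (rule inj_on_subset) blast
    ultimately have "f ` S = S" by (rule endo_inj_surj)
    then have "y \<in> f ` S" using y p(3) unfolding S_def by blast
    then show "y \<in> f ` B" unfolding S_def by blast
  qed
  with inj fB have "bij_betw f B B" by (simp add: bij_betw_def)
  moreover have "f (x + y) = f x + f y" "f (x * y) = f x * f y" if "x \<in> B" "y \<in> B" for x y
    using field_corr_add[OF G(1) f[OF that(1)] f[OF that(2)]]
      field_corr_mult[OF G(1) f[OF that(1)] f[OF that(2)]] by (auto intro: f_eq)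
  moreover have "f a = a" if "a \<in> A" for a using that G0(2) G(2) by (intro f_eq) (auto simp: Id_on_iff)
  moreover have "f b = b'" using G0(3) G(2) by (intro f_eq) blast
  ultimately show ?thesis using that by blast
qed

section \<open>From structures to subfields and ring isomorphisms\<close>

lemma subfield_set_if_closed:
  assumes M: "substruct (field_lang :: ('f, 'r) lang) M (field_struct :: ('a::field, 'f, 'r) struct)"
    and A: "A \<subseteq> univ M"
    and closed: "\<And>s xs. s \<in> fsyms (field_lang :: ('f, 'r) lang) \<Longrightarrow> set xs \<subseteq> A \<Longrightarrow> length xs = arity s \<Longrightarrow>
      fint M s xs \<in> A"
  shows "subfield_set A"
proof -
  have *: "field_fint s xs \<in> A"
    if "s \<in> fsyms (field_lang :: ('f, 'r) lang)" "set xs \<subseteq> A" "length xs = arity s" for s xs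
    using closed[OF that] M A that unfolding substruct_def by fastforce
  show ?thesis
    using *[of FZero "[]"] *[of FOne "[]"] *[of FPlus "[_, _]"] *[of FTimes "[_, _]"]
      *[of FNeg "[_]"] *[of FInv "[_]"]
    by (simp add: subfield_set_def field_lang_def)
qed

lemma dcl_closed:
  assumes N: "is_struct L N" and A: "A \<subseteq> univ N" "dcl L N A = A"
    and s: "s \<in> fsyms L" and xs: "set xs \<subseteq> A" "length xs = arity s"
  shows "fint N s xs \<in> A"
proof -
  let ?t = "TApp s (map TVar [0..<length xs])"
  have val: "tm_val N ((!) xs) ?t = fint N s xs" by (simp add: comp_def map_nth)
  have "fint N s xs \<in> univ N" using N A(1) s xs unfolding is_struct_def by blast
  then have "tm_val N ((!) xs) ?t \<in> univ N" using val by simp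
  then have "tm_val N ((!) xs) ?t \<in> dcl L N A"
    by (rule tm_val_in_dcl[rotated 2]) (use s xs in auto)
  then show ?thesis using val A(2) by simp
qed

lemma concrete_field_ring_of:
  assumes F: "field (ring_of M)"
    and M: "substruct (field_lang :: ('f, 'r) lang) M (field_struct :: ('a::field, 'f, 'r) struct)"
  shows "concrete_field (ring_of M)"
proof -
  have eq: "fint M s xs = field_fint s xs"
    if "s \<in> fsyms (field_lang :: ('f, 'r) lang)" "set xs \<subseteq> univ M" "length xs = arity s" for s xs
    using M that unfolding substruct_def by simp
  show ?thesis
    using F unfolding concrete_field_def concrete_field_axioms_def
    by (auto simp: ring_of_def eq field_lang_def)
qed

lemma ring_iso_ring_of:
  fixes f :: "'a::field \<Rightarrow> 'a"
  assumes M: "substruct (field_lang :: ('f, 'r) lang) M (field_struct :: ('a, 'f, 'r) struct)"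
    and B: "B \<subseteq> univ M" and f: "bij_betw f B B"
    "\<And>x y. x \<in> B \<Longrightarrow> y \<in> B \<Longrightarrow> f (x + y) = f x + f y"
    "\<And>x y. x \<in> B \<Longrightarrow> y \<in> B \<Longrightarrow> f (x * y) = f x * f y" "f 1 = 1"
  shows "f \<in> ring_iso (ring_of (M\<lparr>univ := B\<rparr>)) (ring_of (M\<lparr>univ := B\<rparr>))"
proof -
  have eq: "fint M s xs = field_fint s xs"
    if "s \<in> fsyms (field_lang :: ('f, 'r) lang)" "set xs \<subseteq> univ M" "length xs = arity s" for s xs
    using M that unfolding substruct_def by simp
  have fB: "f x \<in> B" if "x \<in> B" for x using bij_betw_apply[OF f(1) that] .
  have *: "fint M FPlus [x, y] = x + y" "fint M FTimes [x, y] = x * y" "fint M FOne [] = 1"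
    if "x \<in> B" "y \<in> B" for x y
    using that B eq[of FPlus "[x, y]"] eq[of FTimes "[x, y]"] eq[of FOne "[]"]
    by (auto simp: field_lang_def)
  have one: "fint M FOne [] = 1" using eq[of FOne "[]"] by (simp add: field_lang_def)
  show ?thesis
    unfolding ring_iso_def ring_hom_def using f fB by (simp add: ring_of_def * one)
qed

theorem lemma1p12:
  fixes L :: "('f, 'r) lang" and T :: "('f, 'r) fm set" and p :: nat
    and \<kappa> :: "'k rel"
    and M M0 :: "('a::alg_closed_field, 'f, 'r) struct"
    and \<K> :: "'a set set"
  assumes lang: "sublang field_lang L"
    and complete: "complete_theory TYPE('a) L T"
    and char: "p = 0 \<or> prime p"
    and fields: "\<And>N :: ('a, 'f, 'r) struct. is_model L N T \<Longrightarrow> is_field_struct p N"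
    and kappa: "Card_order \<kappa>" "(card_of {\<phi>. formula_of L \<phi>}, \<kappa>) \<in> ordLess"
    and M: "is_model L M T" "saturated L \<kappa> M"
    and M0: "M0 = field_struct" "saturated field_lang \<kappa> M0"
    and M_M0: "substruct field_lang M M0"
    and strong: "strong_class L M \<K>"
    and hyp1: "\<And>A. A \<subseteq> univ M \<Longrightarrow> dcl L M A = A \<Longrightarrow> A \<in> \<K>"
    and hyp2_1: "\<And>N :: ('a, 'f, 'r) struct. is_model L N T \<Longrightarrow> separably_closed (ring_of N)"
    and hyp2_2: "\<And>A. A \<in> \<K> \<Longrightarrow> separable_extension p (ring_of M) A"
    and hyp3_1: "\<And>A. A \<in> \<K> \<Longrightarrow> acl L M A = acl field_lang M0 A \<inter> univ M"
    and hyp3_2: "\<And>A f B. \<lbrakk> A \<in> \<K>; B = acl field_lang M0 A \<inter> univ M;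
        f \<in> ring_iso (ring_of (M\<lparr>univ := B\<rparr>)) (ring_of (M\<lparr>univ := B\<rparr>)); \<forall>a\<in>A. f a = a \<rbrakk>
        \<Longrightarrow> is_iso L f (M\<lparr>univ := B\<rparr>) (M\<lparr>univ := B\<rparr>)"
  shows "\<forall>A\<in>\<K>. dcl L M A = dcl field_lang M0 A \<inter> univ M \<and> dcl field_lang M0 A \<inter> univ M = A"
proof
  fix A assume AK: "A \<in> \<K>"
  define R where "R = ring_of M"
  have carrier: "carrier R = univ M" by (simp add: R_def ring_of_def)
  note sat0 = M0(2)[unfolded M0(1)]
  note sub = M_M0[unfolded M0(1)]
  have structM: "is_struct L M" using M(1) by (simp add: is_model_def)
  have ne: "univ M \<noteq> {}" using structM by (simp add: is_struct_def)
  have fieldM: "is_field_struct p M" using fields[OF M(1)] .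
  have R: "concrete_field R"
    unfolding R_def by (rule concrete_field_ring_of[OF _ sub]) (use fieldM in \<open>simp add: is_field_struct_def\<close>)
  then interpret concrete_field R .
  have CHAR: "CHAR('a) = p"
  proof -
    have "of_nat n = (0 :: 'a) \<longleftrightarrow> p dvd n" for n
    proof -
      have "[n] \<cdot>\<^bsub>R\<^esub> \<one>\<^bsub>R\<^esub> = \<zero>\<^bsub>R\<^esub> \<longleftrightarrow> p dvd n"
        using fieldM unfolding is_field_struct_def R_def[symmetric] by blast
      then show ?thesis using add_pow_eq[OF one_closed, of n] by (simp add: one_eq zero_eq)
    qed
    then show ?thesis by (intro CHAR_eqI) auto
  qed
  have AM: "A \<subseteq> univ M" and subA: "substruct L (M\<lparr>univ := A\<rparr>) M"
    using strong AK by (auto simp: strong_class_def substruct_def)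
  have fl: "s \<in> fsyms L" if "s \<in> fsyms (field_lang :: ('f, 'r) lang)" for s
    using lang that by (auto simp: sublang_def)
  have A: "subfield_set A"
    using subA fl by (intro subfield_set_if_closed[OF sub AM]) (auto simp: substruct_def is_struct_def)
  define B where "B = acl L M A"
  have B_eq: "B = acl field_lang M0 A \<inter> univ M" using hyp3_1[OF AK] by (simp add: B_def)
  have BM: "B \<subseteq> univ M" and AB: "A \<subseteq> B"
    unfolding B_def by (rule acl_subset_univ, rule subset_acl[OF AM])
  have dclB: "dcl L M B = B"
    using subset_dcl[OF BM, of L] dcl_subset_acl[of L M B] acl_acl[OF ne AM, of L] unfolding B_def by blast
  have BK: "B \<in> \<K>" using hyp1[OF BM dclB] .
  \<comment> \<open>Definable closedness also gives closure under the function symbols, hence a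
    subfield.\<close>
  have B: "subfield_set B"
    by (rule subfield_set_if_closed[OF sub BM], rule dcl_closed[OF structM BM dclB fl])
  note G = field_corr_Id_on[OF A]
  have alg: "\<exists>p. (\<forall>i. poly.coeff p i \<in> A) \<and> p \<noteq> 0 \<and> poly p x = 0" if "x \<in> B" for x
  proof -
    have "x \<in> acl field_lang (field_struct :: ('a, 'f, 'r) struct) A" using that M0(1) B_eq by simp
    then show ?thesis by (rule acl_field_algebraic[OF sat0 lang kappa(2) A]) auto
  qed
  have min_pair: "\<exists>m. min_pair (Id_on A) x m m \<and> (\<forall>s. poly m s = 0 \<longrightarrow> poly (pderiv m) s \<noteq> 0)"
    if x: "x \<in> B" for x
  proof -
    obtain q where q: "\<And>i. poly.coeff q i \<in> A" "q \<noteq> 0" "poly q x = 0" using alg[OF x] by blast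
    then have "poly_pair (Id_on A) q q" by (simp add: poly_pair_Id_on)
    then obtain m m' where m: "min_pair (Id_on A) x m m'"
      using min_pair_exists[OF G _ q(2,3)] by metis
    then have "m' = m" using min_pairD(1)[OF m] by (simp add: poly_pair_Id_on)
    have "separable_extension p R A" using hyp2_2[OF AK] by (simp add: R_def)
    then have "pderiv m \<noteq> 0"
      using pderiv_min_pair_nonzero[OF _ char CHAR A _ _ m] AM BM x by (auto simp: carrier)
    then show ?thesis using m min_pair_separable[OF A m] \<open>m' = m\<close> by blast
  qed
  have normal: "y \<in> B" if x: "x \<in> B" and conj: "conjugate (Id_on A) x y" for x y
  proof -
    obtain m where m: "min_pair (Id_on A) x m m" "\<And>s. poly m s = 0 \<Longrightarrow> poly (pderiv m) s \<noteq> 0"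
      using min_pair[OF x] by blast
    note mD = min_pairD[OF m(1)]
    have "poly m y = 0" using conj mD(1,3) unfolding conjugate_def by blast
    moreover have "poly.coeff m i \<in> carrier R" for i
      using mD(1) AM unfolding carrier poly_pair_Id_on by blast
    \<comment> \<open>Every root of \<open>m\<close> is in \<open>M\<close>, not just one;
      membership in the algebraic closure is a separate matter, settled next by conjugacy.\<close>
    ultimately have "y \<in> univ M"
      using root_in_separably_closed[OF R _ _ mD(4) m(2)] hyp2_1[OF M(1)] carrier R_def by metis
    moreover have "y \<in> acl field_lang M0 A"
    proof -
      obtain \<phi> e where \<phi>: "param_formula field_lang A \<phi> e" "finite (solutions M0 \<phi> e)" "x \<in> solutions M0 \<phi> e"
        using x unfolding B_eq acl_def by blast
      have "y \<in> solutions M0 \<phi> e"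
        using solutions_conjugate[OF sat0 lang kappa(2) A \<phi>(1) _ conj] \<phi>(3) by (simp add: M0(1))
      then show ?thesis using \<phi> unfolding acl_def by blast
    qed
    ultimately show ?thesis by (simp add: B_eq)
  qed
  have moved: "\<exists>b'. b' \<noteq> b \<and> conjugate (Id_on A) b b'" if b: "b \<in> B" "b \<notin> A" for b
  proof -
    obtain m where m: "min_pair (Id_on A) b m m" "\<And>s. poly m s = 0 \<Longrightarrow> poly (pderiv m) s \<noteq> 0"
      using min_pair[OF b(1)] by blast
    note mD = min_pairD[OF m(1)]
    \<comment> \<open>The conjugate is a root of the cofactor \<open>q\<close>. That
      \<open>q\<close> is nonconstant uses \<open>b \<notin> A\<close>, since otherwise
      \<open>m = X - b\<close>; the root differs from \<open>b\<close> because \<open>b\<close> is a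
      simple root of \<open>m\<close>.\<close>
    obtain q where q: "m = [:- b, 1:] * q" using mD(3) by (metis poly_eq_0_iff_dvd dvdE)
    have "degree q > 0"
    proof (rule ccontr)
      assume "\<not> degree q > 0"
      then obtain c where c: "q = [:c:]" by (auto elim: degree_eq_zeroE)
      then have "c = 1" using mD(2,4) q by (auto split: if_splits)
      then have "poly.coeff m 0 = - b" using q c by simp
      then have "- b \<in> A" using mD(1) unfolding poly_pair_Id_on by metis
      then have "- (- b) \<in> A" using A unfolding subfield_set_def by blast
      then show False using b(2) by simp
    qed
    then obtain b' where b': "poly q b' = 0" using alg_closed_imp_poly_has_root by blast
    have "b' \<noteq> b"
    proof
      assume "b' = b"
      then have "poly (pderiv m) b = 0" using b' unfolding q pderiv_mult by simp
      then show False using m(2) mD(3) by blast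
    qed
    moreover have "conjugate (Id_on A) b b'"
      using b' by (intro min_pair_conjugate[OF G m(1)]) (simp add: q)
    ultimately show ?thesis by blast
  qed
  have "dcl field_lang M0 A \<inter> univ M \<subseteq> A"
  proof
    fix b assume b: "b \<in> dcl field_lang M0 A \<inter> univ M"
    show "b \<in> A"
    proof (rule ccontr)
      assume "b \<notin> A"
      moreover have "b \<in> B" using b unfolding B_eq by (auto intro: subsetD[OF dcl_subset_acl])
      ultimately obtain b' where b': "b' \<noteq> b" "conjugate (Id_on A) b b'" using moved by blast
      obtain \<phi> e where \<phi>: "param_formula field_lang A \<phi> e" "solutions M0 \<phi> e = {b}"
        using b unfolding dcl_def by blast
      have "b' \<in> solutions M0 \<phi> e"
        using solutions_conjugate[OF sat0 lang kappa(2) A \<phi>(1) _ b'(2)] \<phi>(2) by (simp add: M0(1))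
      then show False using \<phi>(2) b'(1) by simp
    qed
  qed
  moreover have "dcl L M A \<subseteq> A"
  proof
    fix b assume b: "b \<in> dcl L M A"
    show "b \<in> A"
    proof (rule ccontr)
      assume "b \<notin> A"
      moreover have bB: "b \<in> B" unfolding B_def by (rule subsetD[OF dcl_subset_acl b])
      ultimately obtain b' where b': "b' \<noteq> b" "conjugate (Id_on A) b b'" using moved by blast
      obtain f where f: "bij_betw f B B" "\<And>x y. x \<in> B \<Longrightarrow> y \<in> B \<Longrightarrow> f (x + y) = f x + f y"
        "\<And>x y. x \<in> B \<Longrightarrow> y \<in> B \<Longrightarrow> f (x * y) = f x * f y" "\<And>a. a \<in> A \<Longrightarrow> f a = a" "f b = b'"
        by (rule normal_automorphism_exists[OF A B AB _ _ bB b'(2)])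
          (erule alg, erule (1) normal, rule that)
      have "f 1 = 1" using f(4) A by (simp add: subfield_set_def)
      then have "is_iso L f (M\<lparr>univ := B\<rparr>) (M\<lparr>univ := B\<rparr>)"
        using hyp3_2[OF AK B_eq ring_iso_ring_of[OF sub BM f(1-3)]] f(4) by blast
      \<comment> \<open>Strength is applied with \<open>B\<close> as both source and target.\<close>
      then have elem: "elementary_map L M f B" using strong BK unfolding strong_class_def by blast
      obtain \<phi> e where \<phi>: "param_formula L A \<phi> e" "solutions M \<phi> e = {b}"
        using b unfolding dcl_def by blast
      \<comment> \<open>The default 0 again: elementarity speaks of valuations all of whose values
        lie in \<open>B\<close>.\<close>
      define e' where "e' x = (if x \<in> free_vars \<phi> - {0} then e x else 0)" for x
      have sol: "solutions M \<phi> e' = {b}"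
        unfolding \<phi>(2)[symmetric] by (rule solutions_cong) (simp add: e'_def)
      have e': "e' x \<in> A" for x using \<phi>(1) A by (auto simp: e'_def param_formula_def subfield_set_def)
      have "range (e'(0 := b)) \<subseteq> B" using e' AB bB by auto
      then have "sat M (e'(0 := b)) \<phi> \<longleftrightarrow> sat M (f \<circ> e'(0 := b)) \<phi>"
        using elem \<phi>(1) unfolding elementary_map_def param_formula_def by blast
      moreover have "f \<circ> e'(0 := b) = e'(0 := b')" using f(4,5) e' by auto
      moreover have "b \<in> solutions M \<phi> e'" using sol by simp
      ultimately have "sat M (e'(0 := b')) \<phi>" unfolding solutions_def by simp
      moreover have "b' \<in> univ M" using normal[OF bB b'(2)] BM by blast
      ultimately have "b' \<in> solutions M \<phi> e'" unfolding solutions_def by blast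
      then show False using sol b'(1) by simp
    qed
  qed
  moreover have "A \<subseteq> dcl L M A" by (rule subset_dcl[OF AM])
  moreover have "A \<subseteq> dcl field_lang M0 A" by (rule subset_dcl) (simp add: M0(1))
  ultimately show "dcl L M A = dcl field_lang M0 A \<inter> univ M \<and> dcl field_lang M0 A \<inter> univ M = A"
    using AM by blast
qed

end
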